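(* There is a constant $C>0$ such that the following holds for every $k\in\mathbb{N}$, with $d=2^k$. Let $\mathcal{H}=\mathcal{A}\otimes\mathcal{B}$ be a finite dimensional bipartite Hilbert space, let $\rho=\sum_{i=1}^d p_i|\psi_i\rangle\langle\psi_i|$ be a density operator on $\mathcal{H}$ given by a pure state ensemble of length $d$, let $$U(\theta_1,\dots,\theta_N)=\prod_{l=1}^N \exp(\sqrt{-1}\,\theta_l V_l)E_l$$ be the parametrized circuit on the $k$-qubit ancilla space $\mathcal{W}=\mathbb{C}^d$, let $T_f(\rho;\theta_1,\dots,\theta_N)$ be the associated cost function, and let $j\in\{1,\dots,N\}$. If the circuit is of sufficient depth, in the sense specified in the context (the left part and the right part of the circuit, split at position $j$, are independent, and the distribution of at least one of them is a unitary $4$-design), then $$\mathrm{Var}\left[\frac{\partial}{\partial\theta_j}T_f(\rho;\theta_1,\dots,\theta_N)\right]\le \frac{C}{2^k},$$ i.e. the variance is $O(1/2^k)$, where $k$ is the number of qubits.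
   Context: All Hilbert spaces are complex and finite dimensional. $\mathcal{H}=\mathcal{A}\otimes\mathcal{B}$; $\mathrm{Tr}_{\mathcal{A}}$ and $\mathrm{Tr}_{\mathcal{W}}$ denote partial traces. The number of qubits $k$ is that of the ancilla space $\mathcal{W}=\mathbb{C}^d$, $d=2^k$, with orthonormal basis $\{|i\rangle\}_{i=1}^d$. Purification: a pure state ensemble of length $d$ consists of numbers $p_i\ge0$ with $\sum_{i=1}^d p_i=1$ and unit vectors $\psi_i\in\mathcal{H}$ with $\rho=\sum_{i=1}^d p_i|\psi_i\rangle\langle\psi_i|$; set $|\psi\rangle=\sum_{i=1}^d\sqrt{p_i}\,|\psi_i\rangle\otimes|i\rangle\in\mathcal{H}\otimes\mathcal{W}$. Circuit: $N$ is the number of layers, $\theta_l\in[0,2\pi)$ are real parameters, each $V_l$ is a $k$-qubit Pauli string (a tensor product of $k$ Pauli or identity matrices, hence Hermitian and unitary on $\mathcal{W}$), and each $E_l$ is a unitary on $\mathcal{W}$ independent of the parameters. The product is ordered from left to right with increasing $l$. Cost function (with $f(x)=x^2$): with $U=U(\theta_1,\dots,\theta_N)$, for $1\le i\le d$ put $$q_i=\langle\psi|(I_{\mathcal{H}}\otimes U^*|i\rangle\langle i|U)|\psi\rangle,\qquad \Phi_i=\mathrm{Tr}_{\mathcal{W}}\big((I_{\mathcal{H}}\otimes U^*|i\rangle\langle i|U)|\psi\rangle\langle\psi|\big).$$ When $q_i\neq0$, $\Phi_i=q_i|\varphi_i\rangle\langle\varphi_i|$ for a unit vector $\varphi_i\in\mathcal{H}$.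 The Tsallis entanglement entropy of a pure state is $T_2(|\varphi\rangle\langle\varphi|)=1-\mathrm{Tr}\big((\mathrm{Tr}_{\mathcal{A}}|\varphi\rangle\langle\varphi|)^2\big)$. The cost function is $$T_f(\rho;\theta_1,\dots,\theta_N)=\sum_{i=1}^d q_i^2\,T_2(|\varphi_i\rangle\langle\varphi_i|)=\sum_{i=1}^d\Big(q_i^2-\mathrm{Tr}\big((\mathrm{Tr}_{\mathcal{A}}\Phi_i)^2\big)\Big)$$ (terms with $q_i=0$ are $0$). Random circuit and sufficient depth: for the given $j$, write $U=LR$ with $$L=\prod_{l=1}^{j}\exp(\sqrt{-1}\,\theta_lV_l)E_l,\qquad R=\prod_{l=j+1}^{N}\exp(\sqrt{-1}\,\theta_lV_l)E_l.$$ The circuit is random: $V_j$ and the $E_l$ are regarded as fixed, while the parameters $\theta_l$ (and possibly the Pauli strings $V_l$, $l\ne j$) are random, in such a way that $L$ and $R$ are independent random unitaries, with laws $\rho_1(L)\,dL$ and $\rho_2(R)\,dR$ on the unitary group $\mathcal{U}(d)$ ($dL,dR$ denoting Haar measure; the laws need not be absolutely continuous). "Sufficient depth" means that at least one of these two laws is a unitary $4$-design, the other being arbitrary. A probability measure $P$ on $\mathcal{U}(d)$ is a unitary $4$-design if $$\int_{\mathcal{U}(d)}U^{\otimes l}\otimes(U^* )^{\otimes l}\,dP(U)=\int_{\mathcal{U}(d)}U^{\otimes l}\otimes(U^* )^{\otimes l}\,dU$$ for all $0\le l\le4$, where $dU$ is normalized Haar measure. The variance is that of the random variable $\partial T_f/\partial\theta_j$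 under this distribution of the circuit. *)

theory Defs
  imports "HOL-Probability.Probability" "Jordan_Normal_Form.Schur_Decomposition"
begin

unbundle no vec_syntax

text \<open>
  Finite-dimensional complex Hilbert spaces are represented as \<open>\<complex>\<^sup>n\<close> (the carrier of
  \<^typ>\<open>complex vec\<close> of dimension \<open>n\<close>), so that dimensions and the number of qubits can be
  quantified inside one formula. All bases are indexed from \<open>0\<close>. The tensor product
  \<open>\<complex>\<^sup>m \<otimes> \<complex>\<^sup>n\<close> is \<open>\<complex>\<^sup>m\<^sup>n\<close>, the basis vector \<open>|a\<rangle> \<otimes> |b\<rangle>\<close> having index \<open>a * n + b\<close>.
\<close>

section \<open>Tensor products, partial traces, matrix exponential\<close>

definition kron_vec :: "complex vec \<Rightarrow> complex vec \<Rightarrow> complex vec" where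
  "kron_vec v w = vec (dim_vec v * dim_vec w)
     (\<lambda>r. v $ (r div dim_vec w) * w $ (r mod dim_vec w))"

definition kron :: "complex mat \<Rightarrow> complex mat \<Rightarrow> complex mat" where
  "kron A B = mat (dim_row A * dim_row B) (dim_col A * dim_col B)
     (\<lambda>(r, c). A $$ (r div dim_row B, c div dim_col B) * B $$ (r mod dim_row B, c mod dim_col B))"

primrec kron_pow :: "nat \<Rightarrow> complex mat \<Rightarrow> complex mat" where
  "kron_pow 0 A = 1\<^sub>m 1"
| "kron_pow (Suc l) A = kron A (kron_pow l A)"

definition ketbra :: "complex vec \<Rightarrow> complex mat" where
  "ketbra v = mat (dim_vec v) (dim_vec v) (\<lambda>(r, c). v $ r * cnj (v $ c))"

definition mtrace :: "complex mat \<Rightarrow> complex" where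
  "mtrace A = (\<Sum>r<dim_row A. A $$ (r, r))"

text \<open>Partial traces over the first and over the second factor of \<open>\<complex>\<^sup>m \<otimes> \<complex>\<^sup>n\<close>.\<close>

definition ptrace_fst :: "nat \<Rightarrow> nat \<Rightarrow> complex mat \<Rightarrow> complex mat" where
  "ptrace_fst m n X = mat n n (\<lambda>(r, c). \<Sum>a<m. X $$ (a * n + r, a * n + c))"

definition ptrace_snd :: "nat \<Rightarrow> nat \<Rightarrow> complex mat \<Rightarrow> complex mat" where
  "ptrace_snd m n X = mat m m (\<lambda>(r, c). \<Sum>b<n. X $$ (r * n + b, c * n + b))"

definition mat_exp :: "complex mat \<Rightarrow> complex mat" where
  "mat_exp A = mat (dim_row A) (dim_row A) (\<lambda>(r, c). \<Sum>n. (A ^\<^sub>m n) $$ (r, c) / fact n)"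

section \<open>Unitary group, Haar measure, unitary designs\<close>

definition unitary_group :: "nat \<Rightarrow> complex mat set" where
  "unitary_group d =
     {U \<in> carrier_mat d d. mat_adjoint U * U = 1\<^sub>m d \<and> U * mat_adjoint U = 1\<^sub>m d}"

text \<open>
  The Borel \<open>\<sigma>\<close>-algebra of the unitary group: the one induced by the embedding of matrices
  into \<open>\<complex>\<^bsup>d\<times>d\<^esup>\<close> via their entries. (\<^typ>\<open>complex mat\<close> carries no topology in the library.)
\<close>

definition unitary_borel :: "nat \<Rightarrow> complex mat measure" where
  "unitary_borel d = vimage_algebra (unitary_group d)
     (\<lambda>U. \<lambda>rc\<in>{..<d} \<times> {..<d}. U $$ rc) (\<Pi>\<^sub>M rc\<in>{..<d} \<times> {..<d}. (borel :: complex measure))"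

text \<open>
  Normalized Haar measure, i.e. the left-invariant Borel probability measure. It exists, is
  unique, and is right-invariant as well, since the unitary group is compact.
\<close>

definition is_haar :: "nat \<Rightarrow> complex mat measure \<Rightarrow> bool" where
  "is_haar d \<mu> \<longleftrightarrow> prob_space \<mu> \<and> sets \<mu> = sets (unitary_borel d) \<and>
     (\<forall>V\<in>unitary_group d. distr \<mu> \<mu> (\<lambda>U. V * U) = \<mu>)"

definition mat_integral :: "nat \<Rightarrow> complex mat measure \<Rightarrow> (complex mat \<Rightarrow> complex mat) \<Rightarrow> complex mat"
  where "mat_integral n \<mu> F = mat n n (\<lambda>rc. \<integral>U. F U $$ rc \<partial>\<mu>)"

text \<open>
  By existence and uniqueness of Haar measure, the quantifier over \<open>\<mu>\<close> below just names it.
\<close>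

definition unitary_design :: "nat \<Rightarrow> nat \<Rightarrow> complex mat measure \<Rightarrow> bool" where
  "unitary_design t d P \<longleftrightarrow> prob_space P \<and> sets P = sets (unitary_borel d) \<and>
     (\<exists>\<mu>. is_haar d \<mu> \<and>
       (\<forall>l\<le>t. mat_integral (d ^ l * d ^ l) P (\<lambda>U. kron (kron_pow l U) (kron_pow l (mat_adjoint U))) =
              mat_integral (d ^ l * d ^ l) \<mu> (\<lambda>U. kron (kron_pow l U) (kron_pow l (mat_adjoint U)))))"

section \<open>Parametrized circuits\<close>

datatype pauli = Pauli_I | Pauli_X | Pauli_Y | Pauli_Z

fun pauli_mat :: "pauli \<Rightarrow> complex mat" where
  "pauli_mat Pauli_I = mat_of_rows_list 2 [[1, 0], [0, 1]]"
| "pauli_mat Pauli_X = mat_of_rows_list 2 [[0, 1], [1, 0]]"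
| "pauli_mat Pauli_Y = mat_of_rows_list 2 [[0, - \<i>], [\<i>, 0]]"
| "pauli_mat Pauli_Z = mat_of_rows_list 2 [[1, 0], [0, - 1]]"

definition pauli_strings :: "nat \<Rightarrow> pauli list set" where
  "pauli_strings k = {s. length s = k}"

definition pauli_string_mat :: "pauli list \<Rightarrow> complex mat" where
  "pauli_string_mat s = foldr (\<lambda>p A. kron (pauli_mat p) A) s (1\<^sub>m 1)"

text \<open>
  The ordered product \<open>\<Prod>\<^bsub>l=a\<^esub>\<^bsup>b\<^esup> exp(\<i> \<theta>\<^sub>l V\<^sub>l) E\<^sub>l\<close> on \<open>\<complex>\<^sup>d\<close>, with \<open>l\<close> increasing from left to
  right; it is the identity if \<open>a > b\<close>.
\<close>

definition circuit ::
  "nat \<Rightarrow> (nat \<Rightarrow> complex mat) \<Rightarrow> (nat \<Rightarrow> pauli list) \<Rightarrow> (nat \<Rightarrow> real) \<Rightarrow> nat \<Rightarrow> nat \<Rightarrow> complex mat"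
  where "circuit d E V \<theta> a b =
    foldr (\<lambda>l A. mat_exp ((\<i> * of_real (\<theta> l)) \<cdot>\<^sub>m pauli_string_mat (V l)) * E l * A)
      [a..<Suc b] (1\<^sub>m d)"

section \<open>Ensembles and the cost function\<close>

definition pure_ensemble ::
  "nat \<Rightarrow> nat \<Rightarrow> (nat \<Rightarrow> real) \<Rightarrow> (nat \<Rightarrow> complex vec) \<Rightarrow> complex mat \<Rightarrow> bool" where
  "pure_ensemble n d p \<psi> \<rho> \<longleftrightarrow>
     (\<forall>i<d. p i \<ge> 0) \<and> (\<Sum>i<d. p i) = 1 \<and>
     (\<forall>i<d. \<psi> i \<in> carrier_vec n \<and> \<psi> i \<bullet>c \<psi> i = 1) \<and>
     \<rho> = mat n n (\<lambda>rc. \<Sum>i<d. of_real (p i) * ketbra (\<psi> i) $$ rc)"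

text \<open>The purification \<open>\<Sum>\<^sub>i \<surd>p\<^sub>i \<psi>\<^sub>i \<otimes> |i\<rangle>\<close> in \<open>\<complex>\<^sup>n \<otimes> \<complex>\<^sup>d\<close>.\<close>

definition purification ::
  "nat \<Rightarrow> nat \<Rightarrow> (nat \<Rightarrow> real) \<Rightarrow> (nat \<Rightarrow> complex vec) \<Rightarrow> complex vec" where
  "purification n d p \<psi> =
     vec (n * d) (\<lambda>r. \<Sum>i<d. of_real (sqrt (p i)) * kron_vec (\<psi> i) (unit_vec d i) $ r)"

text \<open>The operator \<open>I \<otimes> U\<^sup>*|i\<rangle>\<langle>i|U\<close> on \<open>\<complex>\<^sup>n \<otimes> \<complex>\<^sup>d\<close>.\<close>

definition meas_op :: "nat \<Rightarrow> nat \<Rightarrow> complex mat \<Rightarrow> nat \<Rightarrow> complex mat" where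
  "meas_op n d U i = kron (1\<^sub>m n) (mat_adjoint U * ketbra (unit_vec d i) * U)"

text \<open>\<open>v \<bullet>c w\<close> is conjugate-linear in \<open>w\<close>, so \<open>\<langle>\<Psi>|M|\<Psi>\<rangle>\<close> is \<open>(M \<Psi>) \<bullet>c \<Psi>\<close>.\<close>

definition outcome_prob :: "nat \<Rightarrow> nat \<Rightarrow> complex vec \<Rightarrow> complex mat \<Rightarrow> nat \<Rightarrow> real" where
  "outcome_prob n d \<Psi> U i = Re ((meas_op n d U i *\<^sub>v \<Psi>) \<bullet>c \<Psi>)"

definition outcome_op :: "nat \<Rightarrow> nat \<Rightarrow> complex vec \<Rightarrow> complex mat \<Rightarrow> nat \<Rightarrow> complex mat" where
  "outcome_op n d \<Psi> U i = ptrace_snd n d (meas_op n d U i * ketbra \<Psi>)"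

text \<open>Tsallis entanglement entropy of the pure state \<open>\<sigma> = |\<phi>\<rangle>\<langle>\<phi>|\<close> on \<open>\<complex>\<^bsup>dA\<^esup> \<otimes> \<complex>\<^bsup>dB\<^esup>\<close>.\<close>

definition tsallis2 :: "nat \<Rightarrow> nat \<Rightarrow> complex mat \<Rightarrow> real" where
  "tsallis2 dA dB \<sigma> = 1 - Re (mtrace (ptrace_fst dA dB \<sigma> * ptrace_fst dA dB \<sigma>))"

text \<open>
  For \<open>q\<^sub>i \<noteq> 0\<close> the post-measurement state \<open>|\<phi>\<^sub>i\<rangle>\<langle>\<phi>\<^sub>i|\<close> is \<open>\<Phi>\<^sub>i / q\<^sub>i\<close>; terms with \<open>q\<^sub>i = 0\<close> vanish.
\<close>

definition cost :: "nat \<Rightarrow> nat \<Rightarrow> nat \<Rightarrow> complex vec \<Rightarrow> complex mat \<Rightarrow> real" where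
  "cost dA dB d \<Psi> U =
     (\<Sum>i<d. let q = outcome_prob (dA * dB) d \<Psi> U i in
        q\<^sup>2 * tsallis2 dA dB (of_real (1 / q) \<cdot>\<^sub>m outcome_op (dA * dB) d \<Psi> U i))"

section \<open>The random circuit\<close>

text \<open>
  A random circuit is given by the joint law of the angles \<open>\<theta>\<^sub>l \<in> [0, 2\<pi>)\<close> and the Pauli strings
  \<open>V\<^sub>l\<close> (\<open>1 \<le> l \<le> N\<close>), a probability measure on the measurable space below. It is arbitrary, so
  deterministic parameters are included; only \<open>V\<^sub>j = S\<close> is fixed. Using this concrete sample space
  rather than one of arbitrary type makes a constant uniform over all random circuits.
\<close>

definition param_space ::
  "nat \<Rightarrow> nat \<Rightarrow> nat \<Rightarrow> pauli list \<Rightarrow> ((nat \<Rightarrow> real) \<times> (nat \<Rightarrow> pauli list)) measure" where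
  "param_space k N j S =
     (\<Pi>\<^sub>M l\<in>{1..N}. restrict_space borel {0..<2 * pi}) \<Otimes>\<^sub>M
     (\<Pi>\<^sub>M l\<in>{1..N}. count_space (if l = j then {S} else pauli_strings k))"

definition sufficient_depth ::
  "nat \<Rightarrow> nat \<Rightarrow> nat \<Rightarrow> (nat \<Rightarrow> complex mat) \<Rightarrow>
   ((nat \<Rightarrow> real) \<times> (nat \<Rightarrow> pauli list)) measure \<Rightarrow> bool" where
  "sufficient_depth d N j E M \<longleftrightarrow>
     (let L = (\<lambda>(\<theta>, V). circuit d E V \<theta> 1 j);
          R = (\<lambda>(\<theta>, V). circuit d E V \<theta> (Suc j) N)
      in prob_space.indep_var M (unitary_borel d) L (unitary_borel d) R \<and>
         (unitary_design 4 d (distr M (unitary_borel d) L) \<or>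
          unitary_design 4 d (distr M (unitary_borel d) R)))"

definition cost_deriv ::
  "nat \<Rightarrow> nat \<Rightarrow> nat \<Rightarrow> complex vec \<Rightarrow> nat \<Rightarrow> (nat \<Rightarrow> complex mat) \<Rightarrow> nat \<Rightarrow>
   (nat \<Rightarrow> real) \<times> (nat \<Rightarrow> pauli list) \<Rightarrow> real" where
  "cost_deriv dA dB d \<Psi> N E j = (\<lambda>(\<theta>, V).
     deriv (\<lambda>t. cost dA dB d \<Psi> (circuit d E V (\<theta>(j := t)) 1 N)) (\<theta> j))"

end

theory Submission
  imports Defs
begin

text \<open>
  Let \<open>x\<^sub>i\<close> be the unnormalized post-measurement vector of outcome \<open>i\<close>, so \<open>q\<^sub>i = \<parallel>x\<^sub>i\<parallel>\<^sup>2\<close>. Its summand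
  in the cost is \<open>q\<^sub>i\<^sup>2 - \<Sum>\<^sub>b\<^sub>c |\<Sum>\<^sub>a x\<^sub>i\<^sub>a\<^sub>b cnj x\<^sub>i\<^sub>a\<^sub>c|\<^sup>2\<close>, whose derivative is at most
  \<open>8 q\<^sub>i sqrt (q\<^sub>i r\<^sub>i)\<close> with \<open>r\<^sub>i = \<parallel>x\<^sub>i'\<parallel>\<^sup>2\<close>. Differentiating in \<open>\<theta>\<^sub>j\<close> is the same as shifting \<open>\<theta>\<^sub>j\<close> by
  \<open>\<pi>/2\<close>, so the \<open>r\<^sub>i\<close> are outcome probabilities of another unitary and sum to 1. By Cauchy-Schwarz
  the squared derivative is at most \<open>64 \<Sum>\<^sub>i q\<^sub>i\<^sup>2\<close>, a polynomial of bidegree (2,2) in the circuit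
  unitary \<open>U = L R\<close>. Under a 2-design for \<open>L\<close> or \<open>R\<close> its mean is its Haar mean, which is at most
  \<open>3 / d\<close>: left translation by the adjoint of \<open>L\<close> times \<open>F D\<close>, with \<open>F\<close> a Hadamard matrix and \<open>D\<close> a random
  diagonal of signs, preserves Haar measure, and averaging over the signs is Khintchine's inequality
  for fourth moments.
\<close>

section \<open>Fourth moments of random signed sums\<close>

text \<open>A sign pattern is encoded by the set \<open>T\<close> of coordinates that are negated,
  so an average over independent signs is a finite sum over a power set.\<close>

definition sgn_flip :: "nat set \<Rightarrow> nat \<Rightarrow> complex" where
  "sgn_flip T s = (if s \<in> T then - 1 else 1)"

lemma cmod_square_parallelogram:
  fixes z w :: complex
  shows "(cmod (z + w))\<^sup>2 + (cmod (z - w))\<^sup>2 = 2 * ((cmod z)\<^sup>2 + (cmod w)\<^sup>2)"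
  unfolding cmod_power2 by (simp add: power2_eq_square algebra_simps)

text \<open>With \<open>c\<close> twice the real inner product of \<open>z\<close> and
  \<open>w\<close>, the two squared moduli are \<open>P + Q + c\<close> and
  \<open>P + Q - c\<close>. The terms odd in \<open>c\<close> cancel when the squares are added, and
  Cauchy-Schwarz bounds the square of \<open>c\<close> by 4 P Q; this yields the coefficient 6 = 2 +
  4.\<close>

lemma cmod_fourth_power_parallelogram:
  fixes z w :: complex
  shows "(cmod (z + w)) ^ 4 + (cmod (z - w)) ^ 4
    \<le> 2 * ((cmod z) ^ 4 + 6 * (cmod z)\<^sup>2 * (cmod w)\<^sup>2 + (cmod w) ^ 4)"
proof -
  define c where "c = 2 * (Re z * Re w + Im z * Im w)"
  define P where "P = (cmod z)\<^sup>2"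
  define Q where "Q = (cmod w)\<^sup>2"
  have plus: "(cmod (z + w))\<^sup>2 = P + Q + c" and minus: "(cmod (z - w))\<^sup>2 = P + Q - c"
    unfolding P_def Q_def c_def cmod_power2 by (simp_all add: power2_eq_square algebra_simps)
  have "(Re z * Re w + Im z * Im w)\<^sup>2 \<le> P * Q"
  proof -
    \<comment> \<open>Lagrange's identity: the defect in Cauchy-Schwarz for two plane vectors is the
      square of their determinant.\<close>
    have "P * Q - (Re z * Re w + Im z * Im w)\<^sup>2 = (Re z * Im w - Im z * Re w)\<^sup>2"
      unfolding P_def Q_def cmod_power2 by (simp add: power2_eq_square algebra_simps)
    then show ?thesis by (metis diff_ge_0_iff_ge zero_le_power2)
  qed
  then have c: "c\<^sup>2 \<le> 4 * (P * Q)"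
    unfolding c_def power_mult_distrib by simp
  have fourth: "x ^ 4 = (x\<^sup>2)\<^sup>2" for x :: real by simp
  have "(cmod (z + w)) ^ 4 + (cmod (z - w)) ^ 4 = 2 * ((P + Q)\<^sup>2 + c\<^sup>2)"
    unfolding fourth plus minus by (simp add: power2_eq_square algebra_simps)
  also have "\<dots> \<le> 2 * ((P + Q)\<^sup>2 + 4 * (P * Q))" using c by simp
  also have "\<dots> = 2 * (P\<^sup>2 + 6 * P * Q + Q\<^sup>2)" by (simp add: power2_eq_square algebra_simps)
  finally show ?thesis unfolding fourth P_def Q_def .
qed

text \<open>Serves the inductions over sign patterns: every pattern on \<open>A\<close> extends to
  \<open>a\<close> with either sign.\<close>

lemma sum_Pow_insert:
  fixes f :: "'a set \<Rightarrow> 'b::comm_monoid_add"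
  assumes "finite A" "a \<notin> A"
  shows "sum f (Pow (insert a A)) = (\<Sum>T\<in>Pow A. f T + f (insert a T))"
proof -
  have "sum f (Pow (insert a A)) = sum f (Pow A) + sum f (insert a ` Pow A)"
    unfolding Pow_insert using assms by (intro sum.union_disjoint) auto
  also have "sum f (insert a ` Pow A) = (\<Sum>T\<in>Pow A. f (insert a T))"
    using assms by (subst sum.reindex) (auto intro!: inj_onI simp: o_def)
  finally show ?thesis by (simp add: sum.distrib)
qed

lemma sgn_flip_sum_insert:
  assumes "finite A" "a \<notin> A" "T \<subseteq> A"
  shows "(\<Sum>s\<in>insert a A. sgn_flip T s * y s) = (\<Sum>s\<in>A. sgn_flip T s * y s) + y a"
    and "(\<Sum>s\<in>insert a A. sgn_flip (insert a T) s * y s) = (\<Sum>s\<in>A. sgn_flip T s * y s) - y a"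
proof -
  have "(\<Sum>s\<in>A. sgn_flip (insert a T) s * y s) = (\<Sum>s\<in>A. sgn_flip T s * y s)"
    using assms by (intro sum.cong) (auto simp: sgn_flip_def)
  then show "(\<Sum>s\<in>insert a A. sgn_flip (insert a T) s * y s) = (\<Sum>s\<in>A. sgn_flip T s * y s) - y a"
    using assms by (simp add: sgn_flip_def)
  show "(\<Sum>s\<in>insert a A. sgn_flip T s * y s) = (\<Sum>s\<in>A. sgn_flip T s * y s) + y a"
    using assms by (auto simp: sgn_flip_def)
qed

text \<open>The two signs of a new coordinate cancel its cross term by the parallelogram
  law.\<close>

lemma second_moment_random_signs:
  assumes "finite A"
  shows "(\<Sum>T\<in>Pow A. (cmod (\<Sum>s\<in>A. sgn_flip T s * y s))\<^sup>2)
    = 2 ^ card A * (\<Sum>s\<in>A. (cmod (y s))\<^sup>2)"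
  using assms
proof (induction A rule: finite_induct)
  case (insert a A)
  have "(\<Sum>T\<in>Pow (insert a A). (cmod (\<Sum>s\<in>insert a A. sgn_flip T s * y s))\<^sup>2)
    = (\<Sum>T\<in>Pow A. 2 * (cmod (\<Sum>s\<in>A. sgn_flip T s * y s))\<^sup>2 + 2 * (cmod (y a))\<^sup>2)"
    unfolding sum_Pow_insert[OF insert.hyps]
    by (intro sum.cong refl, drule PowD)
      (simp only: sgn_flip_sum_insert[OF insert.hyps] cmod_square_parallelogram distrib_left)
  also have "\<dots> = 2 ^ card (insert a A) * (\<Sum>s\<in>insert a A. (cmod (y s))\<^sup>2)"
    unfolding sum.distrib sum_distrib_left[symmetric] insert.IH
    using insert.hyps by (simp add: card_Pow algebra_simps)
  finally show ?case .
qed simp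

text \<open>Induction on the coordinates: summing over the sign of the new one leaves a mixed term
  quadratic in the old signed sum, and the second moment evaluates that term exactly.\<close>

lemma Khintchine_fourth_moment:
  assumes "finite A"
  shows "(\<Sum>T\<in>Pow A. (cmod (\<Sum>s\<in>A. sgn_flip T s * y s)) ^ 4)
    \<le> 2 ^ card A * (3 * (\<Sum>s\<in>A. (cmod (y s))\<^sup>2)\<^sup>2)"
  using assms
proof (induction A rule: finite_induct)
  case (insert a A)
  define z where "z T = (\<Sum>s\<in>A. sgn_flip T s * y s)" for T
  define S where "S = (\<Sum>s\<in>A. (cmod (y s))\<^sup>2)"
  have "(\<Sum>T\<in>Pow (insert a A). (cmod (\<Sum>s\<in>insert a A. sgn_flip T s * y s)) ^ 4)
    = (\<Sum>T\<in>Pow A. (cmod (z T + y a)) ^ 4 + (cmod (z T - y a)) ^ 4)"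
    unfolding sum_Pow_insert[OF insert.hyps]
    by (intro sum.cong refl, drule PowD)
      (simp only: sgn_flip_sum_insert[OF insert.hyps] z_def)
  also have "\<dots> \<le> (\<Sum>T\<in>Pow A. 2 * ((cmod (z T)) ^ 4 + 6 * (cmod (z T))\<^sup>2 * (cmod (y a))\<^sup>2 + (cmod (y a)) ^ 4))"
    by (intro sum_mono cmod_fourth_power_parallelogram)
  also have "\<dots> = 2 * ((\<Sum>T\<in>Pow A. (cmod (z T)) ^ 4) + 6 * (\<Sum>T\<in>Pow A. (cmod (z T))\<^sup>2) * (cmod (y a))\<^sup>2
      + 2 ^ card A * (cmod (y a)) ^ 4)"
    using insert.hyps
    by (simp add: sum.distrib sum_distrib_left sum_distrib_right card_Pow algebra_simps)
  also have "\<dots> \<le> 2 * (2 ^ card A * (3 * S\<^sup>2) + 6 * (2 ^ card A * S) * (cmod (y a))\<^sup>2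
      + 2 ^ card A * (cmod (y a)) ^ 4)"
    using insert.IH second_moment_random_signs[OF insert.hyps(1), of y] by (simp add: z_def S_def)
  also have "\<dots> \<le> 2 ^ card (insert a A) * (3 * (S + (cmod (y a))\<^sup>2)\<^sup>2)"
  proof -
    \<comment> \<open>The constant 3 closes the induction: with t the new weight, expanding the
      right side gives the mixed term 6 S t exactly and 3 t^2 to cover t^2.\<close>
    have "3 * S\<^sup>2 + 6 * S * (cmod (y a))\<^sup>2 + (cmod (y a)) ^ 4 \<le> 3 * (S + (cmod (y a))\<^sup>2)\<^sup>2"
      by (simp add: power2_eq_square power4_eq_xxxx algebra_simps)
    then have "2 ^ Suc (card A) * (3 * S\<^sup>2 + 6 * S * (cmod (y a))\<^sup>2 + (cmod (y a)) ^ 4)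
      \<le> 2 ^ Suc (card A) * (3 * (S + (cmod (y a))\<^sup>2)\<^sup>2)"
      by (intro mult_left_mono) auto
    then show ?thesis using insert.hyps by (simp add: algebra_simps)
  qed
  finally show ?case using insert.hyps by (simp add: S_def add.commute)
qed simp

section \<open>Differentiating the entropy of an unnormalized bipartite vector\<close>

text \<open>A vector of a bipartite space is treated as the array of its coefficients
  \<open>x a b\<close>, so that its dependence on an angle can be differentiated entry by
  entry.\<close>

definition amp_norm2 :: "nat \<Rightarrow> nat \<Rightarrow> (nat \<Rightarrow> nat \<Rightarrow> complex) \<Rightarrow> real" where
  "amp_norm2 m n x = (\<Sum>a<m. \<Sum>b<n. (cmod (x a b))\<^sup>2)"

text \<open>For \<open>x = y\<close> this is the reduced operator of \<open>x\<close> after tracing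
  out the first factor. Two arguments are kept because the product rule produces mixed
  terms.\<close>

definition amp_gram :: "nat \<Rightarrow> (nat \<Rightarrow> nat \<Rightarrow> complex) \<Rightarrow> (nat \<Rightarrow> nat \<Rightarrow> complex) \<Rightarrow> nat \<Rightarrow> nat \<Rightarrow> complex" where
  "amp_gram m x y b b' = (\<Sum>a<m. x a b * cnj (y a b'))"

text \<open>The entropy term with its normalization cleared: a polynomial in the real and imaginary
  parts of \<open>x\<close>, hence differentiable also where the outcome probability
  vanishes.\<close>

definition amp_entropy :: "nat \<Rightarrow> nat \<Rightarrow> (nat \<Rightarrow> nat \<Rightarrow> complex) \<Rightarrow> real" where
  "amp_entropy m n x = (amp_norm2 m n x)\<^sup>2 - (\<Sum>b<n. \<Sum>b'<n. (cmod (amp_gram m x x b b'))\<^sup>2)"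

lemma amp_norm2_nonneg: "amp_norm2 m n x \<ge> 0"
  by (simp add: amp_norm2_def sum_nonneg)

lemma cmod_sum_Cauchy_Schwarz:
  "(cmod (\<Sum>i\<in>I. f i * g i))\<^sup>2 \<le> (\<Sum>i\<in>I. (cmod (f i))\<^sup>2) * (\<Sum>i\<in>I. (cmod (g i))\<^sup>2)"
proof -
  have "(cmod (\<Sum>i\<in>I. f i * g i))\<^sup>2 \<le> (\<Sum>i\<in>I. cmod (f i) * cmod (g i))\<^sup>2"
    by (intro power_mono) (auto intro!: sum_norm_le simp: norm_mult)
  also have "\<dots> \<le> (\<Sum>i\<in>I. (cmod (f i))\<^sup>2) * (\<Sum>i\<in>I. (cmod (g i))\<^sup>2)"
    by (rule Cauchy_Schwarz_ineq_sum)
  finally show ?thesis .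
qed

text \<open>Cauchy-Schwarz in each entry; the resulting double sum over \<open>b\<close> and
  \<open>b'\<close> factors.\<close>

lemma amp_gram_bound:
  "(\<Sum>b<n. \<Sum>b'<n. (cmod (amp_gram m x y b b'))\<^sup>2) \<le> amp_norm2 m n x * amp_norm2 m n y"
proof -
  have swap: "amp_norm2 m n z = (\<Sum>b<n. \<Sum>a<m. (cmod (z a b))\<^sup>2)" for z
    unfolding amp_norm2_def by (rule sum.swap)
  have "(\<Sum>b<n. \<Sum>b'<n. (cmod (amp_gram m x y b b'))\<^sup>2)
    \<le> (\<Sum>b<n. \<Sum>b'<n. (\<Sum>a<m. (cmod (x a b))\<^sup>2) * (\<Sum>a<m. (cmod (y a b'))\<^sup>2))"
    unfolding amp_gram_def
    by (intro sum_mono order_trans[OF cmod_sum_Cauchy_Schwarz]) simp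
  also have "\<dots> = amp_norm2 m n x * amp_norm2 m n y"
    unfolding swap sum_product ..
  finally show ?thesis .
qed

lemma Re_sum_Cauchy_Schwarz:
  "(\<Sum>i\<in>I. Re (cnj (f i) * g i))\<^sup>2 \<le> (\<Sum>i\<in>I. (cmod (f i))\<^sup>2) * (\<Sum>i\<in>I. (cmod (g i))\<^sup>2)"
proof -
  have "(\<Sum>i\<in>I. Re (cnj (f i) * g i))\<^sup>2 = (Re (\<Sum>i\<in>I. cnj (f i) * g i))\<^sup>2" by simp
  also have "\<dots> \<le> (cmod (\<Sum>i\<in>I. cnj (f i) * g i))\<^sup>2"
    unfolding cmod_power2 by simp
  also have "\<dots> \<le> (\<Sum>i\<in>I. (cmod (cnj (f i)))\<^sup>2) * (\<Sum>i\<in>I. (cmod (g i))\<^sup>2)"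
    by (rule cmod_sum_Cauchy_Schwarz)
  finally show ?thesis by simp
qed

lemma has_real_derivative_cmod_square:
  assumes "(f has_vector_derivative f') (at t)"
  shows "((\<lambda>t. (cmod (f t))\<^sup>2) has_real_derivative 2 * Re (cnj (f t) * f')) (at t)"
proof -
  have "((\<lambda>t. Re (f t)) has_real_derivative Re f') (at t)"
       "((\<lambda>t. Im (f t)) has_real_derivative Im f') (at t)"
    using bounded_linear.has_vector_derivative[OF bounded_linear_Re assms]
      bounded_linear.has_vector_derivative[OF bounded_linear_Im assms]
    unfolding has_real_derivative_iff_has_vector_derivative by this+
  from DERIV_add[OF DERIV_power[OF this(1), of 2] DERIV_power[OF this(2), of 2]]
  show ?thesis unfolding cmod_power2 by (simp add: algebra_simps)
qed

text \<open>The derivative is \<open>2 * q * q' - p'\<close>, with \<open>q\<close> the squared norm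
  and \<open>p'\<close> the derivative of the purity sum. Each of the two terms is at most
  \<open>4 * (q * sqrt (q * r))\<close> in absolute value, which gives the 8.\<close>

lemma amp_entropy_derivative:
  assumes "\<And>a b. a < m \<Longrightarrow> b < n \<Longrightarrow> ((\<lambda>t. x t a b) has_vector_derivative x' a b) (at t)"
  obtains D where "((\<lambda>t. amp_entropy m n (x t)) has_real_derivative D) (at t)"
    "\<bar>D\<bar> \<le> 8 * (amp_norm2 m n (x t) * sqrt (amp_norm2 m n (x t) * amp_norm2 m n x'))"
proof -
  define q where "q = amp_norm2 m n (x t)"
  define r where "r = amp_norm2 m n x'"
  have q0: "q \<ge> 0" and r0: "r \<ge> 0" unfolding q_def r_def by (rule amp_norm2_nonneg)+
  define g' where "g' b b' = amp_gram m x' (x t) b b' + amp_gram m (x t) x' b b'" for b b'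
  have dg: "((\<lambda>t. amp_gram m (x t) (x t) b b') has_vector_derivative g' b b') (at t)"
    if "b < n" "b' < n" for b b'
  proof -
    have "((\<lambda>t. \<Sum>a<m. x t a b * cnj (x t a b')) has_vector_derivative
       (\<Sum>a<m. x t a b * cnj (x' a b') + x' a b * cnj (x t a b'))) (at t)"
      using that
      by (intro has_vector_derivative_sum has_vector_derivative_mult has_vector_derivative_cnj assms) auto
    then show ?thesis by (simp add: amp_gram_def g'_def sum.distrib add.commute)
  qed
  define q' where "q' = (\<Sum>a<m. \<Sum>b<n. 2 * Re (cnj (x t a b) * x' a b))"
  define p' where "p' = (\<Sum>b<n. \<Sum>b'<n. 2 * Re (cnj (amp_gram m (x t) (x t) b b') * g' b b'))"
  have dq: "((\<lambda>t. amp_norm2 m n (x t)) has_real_derivative q') (at t)"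
    unfolding amp_norm2_def q'_def
    by (intro DERIV_sum has_real_derivative_cmod_square assms) auto
  have dp: "((\<lambda>t. \<Sum>b<n. \<Sum>b'<n. (cmod (amp_gram m (x t) (x t) b b'))\<^sup>2) has_real_derivative p') (at t)"
    unfolding p'_def by (intro DERIV_sum has_real_derivative_cmod_square dg) auto
  have D: "((\<lambda>t. amp_entropy m n (x t)) has_real_derivative 2 * q * q' - p') (at t)"
    unfolding amp_entropy_def q_def
    by (rule derivative_eq_intros dq dp refl)+ (simp add: algebra_simps)
  \<comment> \<open>Half of \<open>q'\<close> is the real inner product of \<open>x\<close> and its
    derivative over all index pairs, so Cauchy-Schwarz applies.\<close>
  have "(q' / 2)\<^sup>2 = (\<Sum>z\<in>{..<m} \<times> {..<n}. Re (cnj (case z of (a, b) \<Rightarrow> x t a b) * (case z of (a, b) \<Rightarrow> x' a b)))\<^sup>2"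
    unfolding q'_def sum_distrib_left[symmetric] sum.cartesian_product
    by (simp only: split_def nonzero_mult_div_cancel_left[OF zero_neq_numeral[symmetric]])
  also have "\<dots> \<le> q * r"
    by (rule order_trans[OF Re_sum_Cauchy_Schwarz])
      (simp add: q_def r_def amp_norm2_def sum.cartesian_product split_def)
  finally have "\<bar>q' / 2\<bar> \<le> sqrt (q * r)" by (metis real_sqrt_abs real_sqrt_le_mono)
  then have "\<bar>q'\<bar> \<le> 2 * sqrt (q * r)" by simp
  then have bq: "\<bar>2 * q * q'\<bar> \<le> 4 * (q * sqrt (q * r))"
    using mult_left_mono[of "\<bar>q'\<bar>" "2 * sqrt (q * r)" "2 * q"] q0 by (simp add: abs_mult)
  \<comment> \<open>The product rule splits the derivative of the Gram matrix into two mixed Gram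
    matrices, each of squared Frobenius norm at most \<open>q * r\<close>. Here such a matrix
    \<open>h\<close> is paired with the Gram matrix of \<open>x\<close> itself, whose squared norm
    is at most \<open>q * q\<close>.\<close>
  have gsplit: "\<bar>\<Sum>b<n. \<Sum>b'<n. Re (cnj (amp_gram m (x t) (x t) b b') * h b b')\<bar> \<le> q * sqrt (q * r)"
    if h: "(\<Sum>b<n. \<Sum>b'<n. (cmod (h b b'))\<^sup>2) \<le> q * r" for h
  proof -
    have "(\<Sum>b<n. \<Sum>b'<n. Re (cnj (amp_gram m (x t) (x t) b b') * h b b'))\<^sup>2
      \<le> (\<Sum>b<n. \<Sum>b'<n. (cmod (amp_gram m (x t) (x t) b b'))\<^sup>2) * (\<Sum>b<n. \<Sum>b'<n. (cmod (h b b'))\<^sup>2)"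
      using Re_sum_Cauchy_Schwarz[where I = "{..<n} \<times> {..<n}"
        and f = "\<lambda>z. amp_gram m (x t) (x t) (fst z) (snd z)" and g = "\<lambda>z. h (fst z) (snd z)"]
      by (simp add: sum.cartesian_product split_def)
    also have "\<dots> \<le> (q * q) * (q * r)"
      using amp_gram_bound[of m "x t" "x t" n] h q0 r0
      by (intro mult_mono) (auto simp: q_def intro!: sum_nonneg mult_nonneg_nonneg)
    also have "(q * q) * (q * r) = (q * sqrt (q * r))\<^sup>2"
      using q0 r0 by (simp add: power_mult_distrib power2_eq_square)
    finally show ?thesis
      by (rule power2_le_imp_le[OF order_trans[OF eq_refl[OF power2_abs]]]) (use q0 r0 in simp)
  qed
  have "\<bar>p'\<bar> \<le> 4 * (q * sqrt (q * r))"
  proof -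
    have "p' = 2 * ((\<Sum>b<n. \<Sum>b'<n. Re (cnj (amp_gram m (x t) (x t) b b') * amp_gram m x' (x t) b b'))
       + (\<Sum>b<n. \<Sum>b'<n. Re (cnj (amp_gram m (x t) (x t) b b') * amp_gram m (x t) x' b b')))"
      unfolding p'_def g'_def sum_distrib_left[symmetric] sum.distrib[symmetric]
      by (simp only: distrib_left plus_complex.sel)
    moreover have "\<bar>\<Sum>b<n. \<Sum>b'<n. Re (cnj (amp_gram m (x t) (x t) b b') * amp_gram m x' (x t) b b')\<bar> \<le> q * sqrt (q * r)"
      by (rule gsplit) (use amp_gram_bound[of m x' "x t" n] in \<open>simp add: q_def r_def mult.commute\<close>)
    moreover have "\<bar>\<Sum>b<n. \<Sum>b'<n. Re (cnj (amp_gram m (x t) (x t) b b') * amp_gram m (x t) x' b b')\<bar> \<le> q * sqrt (q * r)"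
      by (rule gsplit) (use amp_gram_bound[of m "x t" x' n] in \<open>simp add: q_def r_def\<close>)
    moreover have "\<bar>z\<bar> \<le> 4 * w" if "z = 2 * (u + v)" "\<bar>u\<bar> \<le> w" "\<bar>v\<bar> \<le> w" for u v w z :: real
    proof -
      have "\<bar>z\<bar> = 2 * \<bar>u + v\<bar>" unfolding that(1) abs_mult by simp
      also have "\<dots> \<le> 2 * (w + w)"
        by (intro mult_left_mono order_trans[OF abs_triangle_ineq add_mono[OF that(2,3)]]) simp
      finally show ?thesis by simp
    qed
    ultimately show ?thesis by blast
  qed
  with bq have "\<bar>2 * q * q' - p'\<bar> \<le> 8 * (q * sqrt (q * r))" by linarith
  then show thesis using D that unfolding q_def r_def by blast
qed

text \<open>Cauchy-Schwarz splits off the sum of the products \<open>q i * r i\<close>, which is at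
  most 1 because each \<open>q i\<close> is at most 1 and the \<open>r i\<close> sum to at most
  1.\<close>

lemma sum_weighted_sqrt_bound:
  fixes q r :: "'i \<Rightarrow> real"
  assumes "finite I" "\<And>i. i \<in> I \<Longrightarrow> q i \<ge> 0" "\<And>i. i \<in> I \<Longrightarrow> r i \<ge> 0"
    "(\<Sum>i\<in>I. q i) \<le> 1" "(\<Sum>i\<in>I. r i) \<le> 1"
  shows "(\<Sum>i\<in>I. q i * sqrt (q i * r i))\<^sup>2 \<le> (\<Sum>i\<in>I. (q i)\<^sup>2)"
proof -
  have "(\<Sum>i\<in>I. q i * sqrt (q i * r i))\<^sup>2 \<le> (\<Sum>i\<in>I. (q i)\<^sup>2) * (\<Sum>i\<in>I. (sqrt (q i * r i))\<^sup>2)"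
    by (rule Cauchy_Schwarz_ineq_sum)
  also have "(\<Sum>i\<in>I. (sqrt (q i * r i))\<^sup>2) = (\<Sum>i\<in>I. q i * r i)"
    using assms by (intro sum.cong) auto
  also have "\<dots> \<le> (\<Sum>i\<in>I. r i)"
  proof (intro sum_mono)
    fix i assume i: "i \<in> I"
    have "q i \<le> (\<Sum>i\<in>I. q i)" using assms i by (intro member_le_sum) auto
    then show "q i * r i \<le> r i" using assms i by (intro mult_left_le_one_le) auto
  qed
  finally have "(\<Sum>i\<in>I. q i * sqrt (q i * r i))\<^sup>2 \<le> (\<Sum>i\<in>I. (q i)\<^sup>2) * (\<Sum>i\<in>I. r i)"
    by (simp add: mult_left_mono sum_nonneg)
  also have "\<dots> \<le> (\<Sum>i\<in>I. (q i)\<^sup>2)"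
    using assms by (intro mult_right_le_one_le sum_nonneg) auto
  finally show ?thesis .
qed

section \<open>Unitary matrices, Kronecker products and Pauli strings\<close>

lemma mat_adjoint_dim [simp]:
  "dim_row (mat_adjoint A) = dim_col A" "dim_col (mat_adjoint A) = dim_row A"
  by (simp_all add: mat_adjoint_def)

lemma mat_adjoint_carrier [simp]: "A \<in> carrier_mat m n \<Longrightarrow> mat_adjoint A \<in> carrier_mat n m"
  by auto

lemma mat_adjoint_index [simp]:
  fixes A :: "complex mat"
  assumes "i < dim_col A" "j < dim_row A"
  shows "mat_adjoint A $$ (i, j) = cnj (A $$ (j, i))"
  using assms by (simp add: mat_adjoint_def mat_of_rows_index)

lemma mat_mult_index:
  fixes A B :: "complex mat"
  assumes "A \<in> carrier_mat m n" "B \<in> carrier_mat n l" "i < m" "j < l"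
  shows "(A * B) $$ (i, j) = (\<Sum>s<n. A $$ (i, s) * B $$ (s, j))"
  using assms by (simp add: scalar_prod_def lessThan_atLeast0)

lemma mat_adjoint_mult:
  fixes A B :: "complex mat"
  assumes "A \<in> carrier_mat m n" "B \<in> carrier_mat n l"
  shows "mat_adjoint (A * B) = mat_adjoint B * mat_adjoint A"
proof (rule eq_matI)
  fix i j assume "i < dim_row (mat_adjoint B * mat_adjoint A)" "j < dim_col (mat_adjoint B * mat_adjoint A)"
  with assms have ij: "i < l" "j < m" by auto
  have "mat_adjoint (A * B) $$ (i, j) = cnj ((A * B) $$ (j, i))"
    using assms ij by (intro mat_adjoint_index) auto
  also have "\<dots> = (\<Sum>s<n. mat_adjoint B $$ (i, s) * mat_adjoint A $$ (s, j))"
    using assms ij by (simp add: mat_mult_index[OF assms] mult.commute del: index_mult_mat)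
  also have "\<dots> = (mat_adjoint B * mat_adjoint A) $$ (i, j)"
    using assms ij by (intro mat_mult_index[symmetric]) auto
  finally show "mat_adjoint (A * B) $$ (i, j) = (mat_adjoint B * mat_adjoint A) $$ (i, j)" .
qed (use assms in auto)

lemma mat_adjoint_adjoint [simp]:
  fixes A :: "complex mat"
  shows "mat_adjoint (mat_adjoint A) = A"
  by (rule eq_matI) auto

lemma unitary_groupD:
  assumes "U \<in> unitary_group d"
  shows "U \<in> carrier_mat d d" "mat_adjoint U * U = 1\<^sub>m d" "U * mat_adjoint U = 1\<^sub>m d"
  using assms by (auto simp: unitary_group_def)

lemma unitary_group_adjoint:
  "U \<in> unitary_group d \<Longrightarrow> mat_adjoint U \<in> unitary_group d"
  by (auto simp: unitary_group_def)

lemma unitary_group_one [simp]: "1\<^sub>m d \<in> unitary_group d"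
proof -
  have "mat_adjoint (1\<^sub>m d :: complex mat) = 1\<^sub>m d" by (rule eq_matI) auto
  then show ?thesis by (simp add: unitary_group_def)
qed

lemma unitary_group_mult:
  assumes "U \<in> unitary_group d" "V \<in> unitary_group d"
  shows "U * V \<in> unitary_group d"
proof -
  note U = unitary_groupD[OF assms(1)] and V = unitary_groupD[OF assms(2)]
  note c = U(1) V(1) mat_adjoint_carrier[OF U(1)] mat_adjoint_carrier[OF V(1)]
  have "mat_adjoint (U * V) * (U * V) = mat_adjoint V * (mat_adjoint U * U) * V"
    using c by (simp add: mat_adjoint_mult[OF U(1) V(1)] assoc_mult_mat[of _ d d _ d _ d] mult_carrier_mat[of _ d d _ d])
  also have "\<dots> = 1\<^sub>m d" using c U V by simp
  finally have 1: "mat_adjoint (U * V) * (U * V) = 1\<^sub>m d" .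
  have "(U * V) * mat_adjoint (U * V) = U * (V * mat_adjoint V) * mat_adjoint U"
    using c by (simp add: mat_adjoint_mult[OF U(1) V(1)] assoc_mult_mat[of _ d d _ d _ d] mult_carrier_mat[of _ d d _ d])
  also have "\<dots> = 1\<^sub>m d" using c U V by simp
  finally show ?thesis using 1 c by (simp add: unitary_group_def)
qed

text \<open>Expanding the squares produces inner products of columns of \<open>U\<close>, which are
  orthonormal. The vector is a plain function so that rows of an amplitude array can be
  inserted.\<close>

lemma unitary_group_norm_preserving:
  assumes U: "U \<in> unitary_group d"
  shows "(\<Sum>i<d. (cmod (\<Sum>s<d. U $$ (i, s) * v s))\<^sup>2) = (\<Sum>s<d. (cmod (v s))\<^sup>2)"
proof -
  note c = unitary_groupD(1)[OF U] mat_adjoint_carrier[OF unitary_groupD(1)[OF U]]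
  have orth: "(\<Sum>i<d. cnj (U $$ (i, t)) * U $$ (i, s)) = (if s = t then 1 else 0)"
    if "s < d" "t < d" for s t
  proof -
    have "(\<Sum>i<d. cnj (U $$ (i, t)) * U $$ (i, s)) = (mat_adjoint U * U) $$ (t, s)"
      using that c by (subst mat_mult_index[of _ d d _ d]) auto
    then show ?thesis using unitary_groupD(2)[OF U] that by auto
  qed
  \<comment> \<open>The computation runs over the complex numbers, where the squared modulus is
    \<open>z * cnj z\<close>, and returns to the reals by injectivity of
    \<open>of_real\<close>.\<close>
  have "of_real (\<Sum>i<d. (cmod (\<Sum>s<d. U $$ (i, s) * v s))\<^sup>2)
     = (\<Sum>i<d. (\<Sum>s<d. U $$ (i, s) * v s) * cnj (\<Sum>t<d. U $$ (i, t) * v t))"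
    by (simp only: of_real_sum complex_norm_square)
  also have "\<dots> = (\<Sum>i<d. \<Sum>s<d. \<Sum>t<d. v s * cnj (v t) * (cnj (U $$ (i, t)) * U $$ (i, s)))"
    by (simp add: sum_product mult_ac)
  also have "\<dots> = (\<Sum>s<d. \<Sum>t<d. \<Sum>i<d. v s * cnj (v t) * (cnj (U $$ (i, t)) * U $$ (i, s)))"
    by (subst sum.swap, rule sum.cong[OF refl], rule sum.swap)
  also have "\<dots> = (\<Sum>s<d. \<Sum>t<d. v s * cnj (v t) * (if s = t then 1 else 0))"
    unfolding sum_distrib_left[symmetric] by (intro sum.cong refl) (simp add: orth)
  also have "\<dots> = (\<Sum>s<d. v s * cnj (v s))"
    by (intro sum.cong refl) (simp add: if_distrib cong: if_cong)
  also have "\<dots> = of_real (\<Sum>s<d. (cmod (v s))\<^sup>2)"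
    by (simp only: of_real_sum complex_norm_square)
  finally show ?thesis by (simp only: of_real_eq_iff)
qed

text \<open>Norm preservation applied to a basis vector. The bound makes monomials in the entries
  integrable.\<close>

lemma unitary_group_entry_le_1:
  assumes U: "U \<in> unitary_group d" and "i < d" "s < d"
  shows "cmod (U $$ (i, s)) \<le> 1"
proof -
  have "(cmod (\<Sum>s'<d. U $$ (i, s') * (if s' = s then 1 else 0)))\<^sup>2
    \<le> (\<Sum>i<d. (cmod (\<Sum>s'<d. U $$ (i, s') * (if s' = s then 1 else 0)))\<^sup>2)"
    using assms by (intro member_le_sum) auto
  also have "\<dots> = (\<Sum>s'<d. (cmod (if s' = s then 1 else 0))\<^sup>2)"
    by (rule unitary_group_norm_preserving[OF U])
  also have "\<dots> = 1"
    using assms by (subst sum.cong[OF refl, of _ _ "\<lambda>s'. if s' = s then 1 else 0"]) auto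
  finally have "(cmod (U $$ (i, s)))\<^sup>2 \<le> 1\<^sup>2" using assms by (simp add: if_distrib cong: if_cong)
  then show ?thesis by (rule power2_le_imp_le) simp
qed

section \<open>Tensor indices and Kronecker products\<close>

lemma sum_mult_lessThan:
  fixes f :: "nat \<Rightarrow> 'a::comm_monoid_add"
  shows "(\<Sum>r<m * n. f r) = (\<Sum>a<m. \<Sum>b<n. f (a * n + b))"
proof -
  have "(\<Sum>r<m * n. f r) = (\<Sum>a<m. sum f {a * n..<a * n + n})"
    by (rule sum.nat_group[symmetric])
  also have "\<dots> = (\<Sum>a<m. \<Sum>b<n. f (a * n + b))"
  proof (rule sum.cong[OF refl])
    show "sum f {a * n..<a * n + n} = (\<Sum>b<n. f (a * n + b))" for a
      using sum.shift_bounds_nat_ivl[of f 0 "a * n" n] by (simp add: lessThan_atLeast0 add.commute)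
  qed
  finally show ?thesis .
qed

lemma mult_add_less:
  fixes a b m n :: nat
  assumes "a < m" "b < n"
  shows "a * n + b < m * n"
proof -
  have "a * n + b < Suc a * n" using assms by simp
  also have "\<dots> \<le> m * n" using assms by (intro mult_right_mono) auto
  finally show ?thesis .
qed

lemma div_less_of_less_mult: "(r::nat) < m * n \<Longrightarrow> r div n < m"
  by (simp add: less_mult_imp_div_less)

lemma mod_less_of_less_mult: "(r::nat) < m * n \<Longrightarrow> r mod n < n"
  by (cases n) auto

lemma kron_carrier [simp]:
  "A \<in> carrier_mat m n \<Longrightarrow> B \<in> carrier_mat m' n' \<Longrightarrow> kron A B \<in> carrier_mat (m * m') (n * n')"
  by (auto simp: kron_def)

lemma kron_index:
  assumes "A \<in> carrier_mat m n" "B \<in> carrier_mat m' n'" "r < m * m'" "c < n * n'"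
  shows "kron A B $$ (r, c) = A $$ (r div m', c div n') * B $$ (r mod m', c mod n')"
  using assms by (auto simp: kron_def)

lemma kron_index_pair:
  assumes "A \<in> carrier_mat m n" "B \<in> carrier_mat m' n'" "r < m" "r' < m'" "c < n" "c' < n'"
  shows "kron A B $$ (r * m' + r', c * n' + c') = A $$ (r, c) * B $$ (r', c')"
  using assms by (simp add: kron_index[OF assms(1,2)] mult_add_less)

text \<open>The mixed-product rule: the summation index splits into a pair, and the sum over pairs
  is a product of two matrix entries.\<close>

lemma kron_mult:
  assumes "A \<in> carrier_mat m n" "B \<in> carrier_mat m' n'" "C \<in> carrier_mat n l" "D \<in> carrier_mat n' l'"
  shows "kron A B * kron C D = kron (A * C) (B * D)"
proof (rule eq_matI)
  fix i j assume "i < dim_row (kron (A * C) (B * D))" "j < dim_col (kron (A * C) (B * D))"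
  with assms have ij: "i < m * m'" "j < l * l'" by (auto simp: kron_def)
  have AC: "A * C \<in> carrier_mat m l" and BD: "B * D \<in> carrier_mat m' l'" using assms by auto
  note b = div_less_of_less_mult[OF ij(1)] mod_less_of_less_mult[OF ij(1)]
    div_less_of_less_mult[OF ij(2)] mod_less_of_less_mult[OF ij(2)]
  have "(kron A B * kron C D) $$ (i, j) = (\<Sum>r<n * n'. kron A B $$ (i, r) * kron C D $$ (r, j))"
    using assms ij by (intro mat_mult_index) auto
  also have "\<dots> = (\<Sum>a<n. \<Sum>b<n'. (A $$ (i div m', a) * C $$ (a, j div l')) * (B $$ (i mod m', b) * D $$ (b, j mod l')))"
    unfolding sum_mult_lessThan
    by (intro sum.cong refl)
      (simp add: kron_index[OF assms(1,2)] kron_index[OF assms(3,4)] ij mult_add_less)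
  also have "\<dots> = (A * C) $$ (i div m', j div l') * (B * D) $$ (i mod m', j mod l')"
    by (simp only: mat_mult_index[OF assms(1,3) b(1,3)] mat_mult_index[OF assms(2,4) b(2,4)] sum_product)
  also have "\<dots> = kron (A * C) (B * D) $$ (i, j)"
    by (rule kron_index[OF AC BD ij, symmetric])
  finally show "(kron A B * kron C D) $$ (i, j) = kron (A * C) (B * D) $$ (i, j)" .
qed (use assms in \<open>auto simp: kron_def\<close>)

lemma mat_adjoint_kron:
  assumes "A \<in> carrier_mat m n" "B \<in> carrier_mat m' n'"
  shows "mat_adjoint (kron A B) = kron (mat_adjoint A) (mat_adjoint B)"
proof (rule eq_matI)
  fix i j assume "i < dim_row (kron (mat_adjoint A) (mat_adjoint B))" "j < dim_col (kron (mat_adjoint A) (mat_adjoint B))"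
  with assms have ij: "i < n * n'" "j < m * m'" by (auto simp: kron_def)
  note b = div_less_of_less_mult[OF ij(1)] mod_less_of_less_mult[OF ij(1)]
    div_less_of_less_mult[OF ij(2)] mod_less_of_less_mult[OF ij(2)]
  note adj = mat_adjoint_carrier[OF assms(1)] mat_adjoint_carrier[OF assms(2)]
  have K: "kron A B \<in> carrier_mat (m * m') (n * n')" using assms by simp
  have "mat_adjoint (kron A B) $$ (i, j) = cnj (kron A B $$ (j, i))"
    using K ij by (intro mat_adjoint_index) auto
  also have "\<dots> = kron (mat_adjoint A) (mat_adjoint B) $$ (i, j)"
    unfolding kron_index[OF adj ij] kron_index[OF assms ij(2,1)]
    using assms b by simp
  finally show "mat_adjoint (kron A B) $$ (i, j) = kron (mat_adjoint A) (mat_adjoint B) $$ (i, j)" .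
qed (use assms in \<open>auto simp: kron_def\<close>)

lemma kron_one: "kron (1\<^sub>m m) (1\<^sub>m n) = 1\<^sub>m (m * n)"
proof (rule eq_matI)
  fix i j assume "i < dim_row (1\<^sub>m (m * n) :: complex mat)" "j < dim_col (1\<^sub>m (m * n) :: complex mat)"
  then have ij: "i < m * n" "j < m * n" by auto
  note b = div_less_of_less_mult[OF ij(1)] mod_less_of_less_mult[OF ij(1)]
    div_less_of_less_mult[OF ij(2)] mod_less_of_less_mult[OF ij(2)]
  have "(i div n = j div n \<and> i mod n = j mod n) \<longleftrightarrow> i = j"
    by (metis div_mult_mod_eq)
  then show "kron (1\<^sub>m m) (1\<^sub>m n) $$ (i, j) = (1\<^sub>m (m * n) :: complex mat) $$ (i, j)"
    using ij b by (auto simp: kron_index[OF one_carrier_mat one_carrier_mat ij])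
qed (auto simp: kron_def)

lemma unitary_group_kron:
  assumes "A \<in> unitary_group m" "B \<in> unitary_group n"
  shows "kron A B \<in> unitary_group (m * n)"
proof -
  note A = unitary_groupD[OF assms(1)] and B = unitary_groupD[OF assms(2)]
  note adj = mat_adjoint_carrier[OF A(1)] mat_adjoint_carrier[OF B(1)]
  show ?thesis
    using A B kron_carrier[OF A(1) B(1)]
    by (simp add: unitary_group_def mat_adjoint_kron[OF A(1) B(1)] kron_mult[OF adj A(1) B(1)]
      kron_mult[OF A(1) B(1) adj] kron_one)
qed

section \<open>Pauli matrices and Pauli strings\<close>

lemma pauli_mat_carrier [simp]: "pauli_mat s \<in> carrier_mat 2 2"
  by (cases s) (auto simp: mat_of_rows_list_def)

lemma pauli_mat_adjoint: "mat_adjoint (pauli_mat s) = pauli_mat s"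
proof (rule eq_matI)
  fix i j assume "i < dim_row (pauli_mat s)" "j < dim_col (pauli_mat s)"
  then have "i < 2" "j < 2" using carrier_matD[OF pauli_mat_carrier[of s]] by auto
  then show "mat_adjoint (pauli_mat s) $$ (i, j) = pauli_mat s $$ (i, j)"
    unfolding less_2_cases_iff by (cases s) (auto simp: mat_of_rows_list_def)
qed (use carrier_matD[OF pauli_mat_carrier[of s]] in auto)

lemma pauli_mat_square: "pauli_mat s * pauli_mat s = 1\<^sub>m 2"
proof (rule eq_matI)
  fix i j assume "i < dim_row (1\<^sub>m 2 :: complex mat)" "j < dim_col (1\<^sub>m 2 :: complex mat)"
  then have ij: "i < 2" "j < 2" by auto
  have "(pauli_mat s * pauli_mat s) $$ (i, j) = (\<Sum>l<2. pauli_mat s $$ (i, l) * pauli_mat s $$ (l, j))"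
    by (rule mat_mult_index[OF pauli_mat_carrier pauli_mat_carrier ij])
  also have "\<dots> = pauli_mat s $$ (i, 0) * pauli_mat s $$ (0, j) + pauli_mat s $$ (i, 1) * pauli_mat s $$ (1, j)"
    by (simp add: numeral_2_eq_2)
  also have "\<dots> = 1\<^sub>m 2 $$ (i, j)"
    using ij unfolding less_2_cases_iff by (cases s) (auto simp: mat_of_rows_list_def)
  finally show "(pauli_mat s * pauli_mat s) $$ (i, j) = 1\<^sub>m 2 $$ (i, j)" .
qed (use carrier_matD[OF pauli_mat_carrier[of s]] in auto)

lemma pauli_string_mat_Cons: "pauli_string_mat (p # s) = kron (pauli_mat p) (pauli_string_mat s)"
  by (simp add: pauli_string_mat_def)

text \<open>One induction carries all three facts, because the rules for adjoints and products of
  Kronecker products need the dimensions of the factors. Being a Hermitian involution is what makes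
  the exponential of a layer explicit and unitary.\<close>

lemma pauli_string_mat_props:
  "pauli_string_mat s \<in> carrier_mat (2 ^ length s) (2 ^ length s) \<and>
   mat_adjoint (pauli_string_mat s) = pauli_string_mat s \<and>
   pauli_string_mat s * pauli_string_mat s = 1\<^sub>m (2 ^ length s)"
proof (induction s)
  case Nil
  have "mat_adjoint (1\<^sub>m 1 :: complex mat) = 1\<^sub>m 1" by (rule eq_matI) auto
  then show ?case by (simp add: pauli_string_mat_def)
next
  case (Cons p s)
  let ?P = "pauli_string_mat s"
  have c: "?P \<in> carrier_mat (2 ^ length s) (2 ^ length s)" using Cons by simp
  show ?case
    using Cons kron_carrier[OF pauli_mat_carrier[of p] c]
    by (simp add: pauli_string_mat_Cons mat_adjoint_kron[OF pauli_mat_carrier c] pauli_mat_adjoint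
      kron_mult[OF pauli_mat_carrier c pauli_mat_carrier c] pauli_mat_square kron_one)
qed

section \<open>Exponentials of involutions and circuits\<close>

lemma smult_smult_mat: "c \<cdot>\<^sub>m (c' \<cdot>\<^sub>m (A :: complex mat)) = (c * c') \<cdot>\<^sub>m A"
  by (rule eq_matI) auto

lemma pow_smult_involution:
  fixes V :: "complex mat"
  assumes V: "V \<in> carrier_mat d d" "V * V = 1\<^sub>m d"
  shows "(c \<cdot>\<^sub>m V) ^\<^sub>m n = c ^ n \<cdot>\<^sub>m (if even n then 1\<^sub>m d else V)"
proof (induction n)
  case 0
  have "1\<^sub>m d = (1::complex) \<cdot>\<^sub>m 1\<^sub>m d" by (rule eq_matI) auto
  then show ?case using V by simp
next
  case (Suc n)
  show ?case
    using V by (cases "even n")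
      (auto simp: Suc mult_smult_assoc_mat[of _ d d _ d] mult_smult_distrib[of _ d d _ d] smult_smult_mat mult.commute)
qed

text \<open>A coefficient alternating between \<open>a\<close> and \<open>b\<close> equals (a + b)/2
  + (-1)^n (a - b)/2, so the series is a combination of those of exp(i t) and exp(-i t).\<close>

lemma parity_exp_series_sums:
  "(\<lambda>n. (\<i> * of_real t) ^ n * (if even n then a else b) / fact n)
    sums (of_real (cos t) * a + \<i> * of_real (sin t) * b)"
proof -
  let ?z = "\<i> * complex_of_real t"
  have e: "(\<lambda>n. x ^ n / fact n) sums exp x" for x :: complex
    using exp_converges[of x] by (simp add: scaleR_conv_of_real divide_inverse mult.commute)
  have "(\<lambda>n. (a + b) / 2 * (?z ^ n / fact n) + (a - b) / 2 * ((- ?z) ^ n / fact n))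
    sums ((a + b) / 2 * exp ?z + (a - b) / 2 * exp (- ?z))"
    by (intro sums_add sums_mult e)
  moreover have "(a + b) / 2 * (?z ^ n / fact n) + (a - b) / 2 * ((- ?z) ^ n / fact n)
    = ?z ^ n * (if even n then a else b) / fact n" for n
    by (cases "even n") (simp_all add: field_simps)
  moreover have "exp ?z = of_real (cos t) + \<i> * of_real (sin t)"
    "exp (- ?z) = of_real (cos t) - \<i> * of_real (sin t)"
    using cis_conv_exp[of t] cis_conv_exp[of "- t"] by (simp_all add: cis_conv_exp[symmetric] complex_eq_iff)
  ultimately show ?thesis by (simp add: algebra_simps add_divide_distrib diff_divide_distrib)
qed

text \<open>Even powers of an involution are the identity and odd powers are \<open>V\<close>, so
  each entry is a series with two alternating coefficients.\<close>

lemma mat_exp_involution: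
  assumes V: "V \<in> carrier_mat d d" "V * V = 1\<^sub>m d"
  shows "mat_exp ((\<i> * of_real t) \<cdot>\<^sub>m V) = of_real (cos t) \<cdot>\<^sub>m 1\<^sub>m d + (\<i> * of_real (sin t)) \<cdot>\<^sub>m V"
proof (rule eq_matI)
  fix r c
  assume "r < dim_row (of_real (cos t) \<cdot>\<^sub>m 1\<^sub>m d + (\<i> * of_real (sin t)) \<cdot>\<^sub>m V)"
    "c < dim_col (of_real (cos t) \<cdot>\<^sub>m 1\<^sub>m d + (\<i> * of_real (sin t)) \<cdot>\<^sub>m V)"
  then have rc: "r < d" "c < d" using V by auto
  have "(((\<i> * of_real t) \<cdot>\<^sub>m V) ^\<^sub>m n) $$ (r, c) / fact n
    = (\<i> * of_real t) ^ n * (if even n then 1\<^sub>m d $$ (r, c) else V $$ (r, c)) / fact n" for n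
    unfolding pow_smult_involution[OF V] using rc V by auto
  then have "mat_exp ((\<i> * of_real t) \<cdot>\<^sub>m V) $$ (r, c)
    = (\<Sum>n. (\<i> * of_real t) ^ n * (if even n then 1\<^sub>m d $$ (r, c) else V $$ (r, c)) / fact n)"
    using rc V by (simp add: mat_exp_def)
  also have "\<dots> = of_real (cos t) * 1\<^sub>m d $$ (r, c) + \<i> * of_real (sin t) * V $$ (r, c)"
    by (rule sums_unique[OF parity_exp_series_sums, symmetric])
  finally show "mat_exp ((\<i> * of_real t) \<cdot>\<^sub>m V) $$ (r, c)
    = (of_real (cos t) \<cdot>\<^sub>m 1\<^sub>m d + (\<i> * of_real (sin t)) \<cdot>\<^sub>m V) $$ (r, c)"
    using rc V by simp
qed (use V in \<open>auto simp: mat_exp_def\<close>)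

lemma rotation_unitary:
  assumes V: "V \<in> carrier_mat d d" "V * V = 1\<^sub>m d" "mat_adjoint V = V"
  shows "of_real (cos t) \<cdot>\<^sub>m 1\<^sub>m d + (\<i> * of_real (sin t)) \<cdot>\<^sub>m V \<in> unitary_group d"
proof -
  \<comment> \<open>\<open>s = 1\<close> is the rotation and \<open>s = - 1\<close> its adjoint;
    keeping \<open>s\<close> as a parameter settles both orders of the product at once.\<close>
  define W where "W s = of_real (cos t) \<cdot>\<^sub>m 1\<^sub>m d + (s * \<i> * of_real (sin t)) \<cdot>\<^sub>m V" for s
  have W: "W s \<in> carrier_mat d d" for s using V by (simp add: W_def)
  have adj: "mat_adjoint (W 1) = W (- 1)"
  proof (rule eq_matI)
    fix i j assume "i < dim_row (W (- 1))" "j < dim_col (W (- 1))"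
    then have ij: "i < d" "j < d" using W[of "- 1"] by auto
    have "cnj (V $$ (j, i)) = V $$ (i, j)"
      using V ij mat_adjoint_index[of i V j] by auto
    then show "mat_adjoint (W 1) $$ (i, j) = W (- 1) $$ (i, j)"
      using ij W[of 1] V by (subst mat_adjoint_index) (auto simp: W_def)
  qed (use W[of 1] W[of "- 1"] in auto)
  have prod: "W s * W (- s) = 1\<^sub>m d" if "s * s = 1" for s
  proof (rule eq_matI)
    fix i j assume "i < dim_row (1\<^sub>m d :: complex mat)" "j < dim_col (1\<^sub>m d :: complex mat)"
    then have ij: "i < d" "j < d" by auto
    let ?c = "of_real (cos t) :: complex" and ?s = "s * \<i> * of_real (sin t)"
    have "W s * W (- s) = (?c \<cdot>\<^sub>m 1\<^sub>m d) * W (- s) + (?s \<cdot>\<^sub>m V) * W (- s)"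
      unfolding W_def[of s] using V W by (intro add_mult_distrib_mat[of _ d d _ _ d]) auto
    also have "(?c \<cdot>\<^sub>m 1\<^sub>m d) * W (- s) = ?c \<cdot>\<^sub>m W (- s)"
      using W by (simp add: mult_smult_assoc_mat[of _ d d _ d] left_mult_one_mat[of _ d d])
    also have "(?s \<cdot>\<^sub>m V) * W (- s) = ?s \<cdot>\<^sub>m (V * W (- s))"
      using W V by (intro mult_smult_assoc_mat[of _ d d _ d]) auto
    also have "V * W (- s) = V * (?c \<cdot>\<^sub>m 1\<^sub>m d) + V * ((- s * \<i> * of_real (sin t)) \<cdot>\<^sub>m V)"
      unfolding W_def using V by (intro mult_add_distrib_mat[of _ d d _ d]) auto
    also have "V * (?c \<cdot>\<^sub>m 1\<^sub>m d) = ?c \<cdot>\<^sub>m V"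
      using V by (simp add: mult_smult_distrib[of _ d d _ d] right_mult_one_mat[of _ d d])
    also have "V * ((- s * \<i> * of_real (sin t)) \<cdot>\<^sub>m V) = (- s * \<i> * of_real (sin t)) \<cdot>\<^sub>m 1\<^sub>m d"
      using V by (simp add: mult_smult_distrib[of _ d d _ d])
    finally have eq: "W s * W (- s) = ?c \<cdot>\<^sub>m W (- s) + ?s \<cdot>\<^sub>m (?c \<cdot>\<^sub>m V + (- s * \<i> * of_real (sin t)) \<cdot>\<^sub>m 1\<^sub>m d)" .
    have "(W s * W (- s)) $$ (i, j) = (?c * ?c + (s * s) * (of_real (sin t) * of_real (sin t))) * 1\<^sub>m d $$ (i, j)"
      by (subst eq) (use ij V in \<open>simp add: W_def algebra_simps\<close>)
    also have "?c * ?c + (s * s) * (of_real (sin t) * of_real (sin t)) = of_real ((cos t)\<^sup>2 + (sin t)\<^sup>2)"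
      unfolding that by (simp only: mult_1 of_real_mult of_real_add power2_eq_square)
    finally show "(W s * W (- s)) $$ (i, j) = 1\<^sub>m d $$ (i, j)" by simp
  qed (use W[of s] W[of "- s"] in auto)
  have "W 1 \<in> unitary_group d"
    using prod[of 1] prod[of "- 1"] W[of 1] by (simp add: unitary_group_def adj)
  then show ?thesis by (simp add: W_def)
qed

section \<open>Ordered products of layers\<close>

lemma foldr_mat_mult:
  fixes F :: "'l \<Rightarrow> complex mat"
  assumes "\<And>l. l \<in> set ls \<Longrightarrow> F l \<in> carrier_mat d d" "X \<in> carrier_mat d d"
  shows "foldr (\<lambda>l A. F l * A) ls (1\<^sub>m d) \<in> carrier_mat d d"
    "foldr (\<lambda>l A. F l * A) ls X = foldr (\<lambda>l A. F l * A) ls (1\<^sub>m d) * X"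
proof -
  have "foldr (\<lambda>l A. F l * A) ls (1\<^sub>m d) \<in> carrier_mat d d \<and>
    foldr (\<lambda>l A. F l * A) ls X = foldr (\<lambda>l A. F l * A) ls (1\<^sub>m d) * X"
    using assms(1)
  proof (induction ls)
    case (Cons l ls)
    then have "F l \<in> carrier_mat d d" by simp
    with Cons assms(2) show ?case
      by (auto intro: mult_carrier_mat simp: assoc_mult_mat[of _ d d _ d _ d])
  qed (use assms(2) in auto)
  then show "foldr (\<lambda>l A. F l * A) ls (1\<^sub>m d) \<in> carrier_mat d d"
    "foldr (\<lambda>l A. F l * A) ls X = foldr (\<lambda>l A. F l * A) ls (1\<^sub>m d) * X" by auto
qed

definition layer :: "(nat \<Rightarrow> complex mat) \<Rightarrow> (nat \<Rightarrow> pauli list) \<Rightarrow> (nat \<Rightarrow> real) \<Rightarrow> nat \<Rightarrow> complex mat" where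
  "layer E V \<theta> l = mat_exp ((\<i> * of_real (\<theta> l)) \<cdot>\<^sub>m pauli_string_mat (V l)) * E l"

lemma circuit_layers: "circuit d E V \<theta> a b = foldr (\<lambda>l A. layer E V \<theta> l * A) [a..<Suc b] (1\<^sub>m d)"
  by (simp add: circuit_def layer_def)

lemma layer_eq:
  assumes "length (V l) = k"
  shows "layer E V \<theta> l = (of_real (cos (\<theta> l)) \<cdot>\<^sub>m 1\<^sub>m (2 ^ k)
    + (\<i> * of_real (sin (\<theta> l))) \<cdot>\<^sub>m pauli_string_mat (V l)) * E l"
  using pauli_string_mat_props[of "V l"] assms
  by (simp add: layer_def mat_exp_involution[of "pauli_string_mat (V l)" "2 ^ k"])

lemma layer_unitary:
  assumes "length (V l) = k" "E l \<in> unitary_group (2 ^ k)"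
  shows "layer E V \<theta> l \<in> unitary_group (2 ^ k)"
  unfolding layer_eq[where V = V and l = l and k = k, OF assms(1)]
  by (intro unitary_group_mult rotation_unitary)
    (use assms pauli_string_mat_props[of "V l"] in auto)

lemma circuit_unitary:
  assumes "\<And>l. l \<in> {a..b} \<Longrightarrow> length (V l) = k" "\<And>l. l \<in> {a..b} \<Longrightarrow> E l \<in> unitary_group (2 ^ k)"
  shows "circuit (2 ^ k) E V \<theta> a b \<in> unitary_group (2 ^ k)"
proof -
  have fold: "foldr (\<lambda>l A. layer E V \<theta> l * A) ls (1\<^sub>m (2 ^ k)) \<in> unitary_group (2 ^ k)"
    if "set ls \<subseteq> {a..b}" for ls
    using that by (induction ls) (auto intro!: unitary_group_mult layer_unitary assms)
  show ?thesis unfolding circuit_layers by (rule fold) auto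
qed

text \<open>Splitting the list of layers reduces this to moving the right part out of the fold. The
  bounds admit \<open>a = Suc j\<close> and \<open>j = b\<close>, where one of the two parts is the
  identity.\<close>

lemma circuit_append:
  assumes "\<And>l. l \<in> {a..b} \<Longrightarrow> length (V l) = k" "\<And>l. l \<in> {a..b} \<Longrightarrow> E l \<in> unitary_group (2 ^ k)"
    and "a \<le> Suc j" "j \<le> b"
  shows "circuit (2 ^ k) E V \<theta> a b = circuit (2 ^ k) E V \<theta> a j * circuit (2 ^ k) E V \<theta> (Suc j) b"
proof -
  have "[a..<Suc b] = [a..<Suc j] @ [Suc j..<Suc b]"
    using assms(3,4) upt_add_eq_append[of a "Suc j" "b - j"] by simp
  then have "circuit (2 ^ k) E V \<theta> a b
    = foldr (\<lambda>l A. layer E V \<theta> l * A) [a..<Suc j] (circuit (2 ^ k) E V \<theta> (Suc j) b)"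
    unfolding circuit_layers by (simp only: foldr_append)
  also have "\<dots> = circuit (2 ^ k) E V \<theta> a j * circuit (2 ^ k) E V \<theta> (Suc j) b"
    unfolding circuit_layers[of _ _ _ _ a j]
  proof (rule foldr_mat_mult(2))
    show "circuit (2 ^ k) E V \<theta> (Suc j) b \<in> carrier_mat (2 ^ k) (2 ^ k)"
      using assms by (intro unitary_groupD circuit_unitary) auto
    show "layer E V \<theta> l \<in> carrier_mat (2 ^ k) (2 ^ k)" if "l \<in> set [a..<Suc j]" for l
      using that assms by (intro unitary_groupD layer_unitary) auto
  qed
  finally show ?thesis .
qed

lemma circuit_cong:
  assumes "\<And>l. l \<in> {a..b} \<Longrightarrow> \<theta> l = \<theta>' l"
  shows "circuit d E V \<theta> a b = circuit d E V \<theta>' a b"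
proof -
  have fold: "foldr (\<lambda>l A. layer E V \<theta> l * A) ls X = foldr (\<lambda>l A. layer E V \<theta>' l * A) ls X"
    if "set ls \<subseteq> {a..b}" for ls X
    using that by (induction ls) (auto simp: layer_def assms)
  show ?thesis unfolding circuit_layers by (rule fold) auto
qed

text \<open>Only layer \<open>j\<close> contains the angle, and its exponential is cos t plus i sin
  t times a Pauli string. The coefficients \<open>A\<close> and \<open>B\<close> are free of
  \<open>t\<close>, which later turns differentiation into a shift of the angle.\<close>

lemma circuit_one_angle:
  assumes V: "\<And>l. l \<in> {1..N} \<Longrightarrow> length (V l) = k"
    and E: "\<And>l. l \<in> {1..N} \<Longrightarrow> E l \<in> unitary_group (2 ^ k)" and j: "j \<in> {1..N}"
  obtains A B where "\<And>t i s. i < 2 ^ k \<Longrightarrow> s < 2 ^ k \<Longrightarrow>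
    circuit (2 ^ k) E V (\<theta>(j := t)) 1 N $$ (i, s) = of_real (cos t) * A i s + of_real (sin t) * B i s"
proof -
  let ?d = "2 ^ k :: nat"
  let ?C = "\<lambda>t a b. circuit ?d E V (\<theta>(j := t)) a b"
  define P where "P = circuit ?d E V \<theta> 1 (j - 1)"
  define Q where "Q = circuit ?d E V \<theta> (Suc j) N"
  define H where "H = pauli_string_mat (V j)"
  have Pc: "P \<in> carrier_mat ?d ?d" and Qc: "Q \<in> carrier_mat ?d ?d"
    unfolding P_def Q_def using V E j by (auto intro!: unitary_groupD(1) circuit_unitary)
  have Ec: "E j \<in> carrier_mat ?d ?d" using E j by (auto dest: unitary_groupD)
  have Hc: "H \<in> carrier_mat ?d ?d" using pauli_string_mat_props[of "V j"] V[OF j] by (simp add: H_def)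
  have EQ: "E j * Q \<in> carrier_mat ?d ?d" using Ec Qc by simp
  have split: "?C t 1 N = P * (of_real (cos t) \<cdot>\<^sub>m (E j * Q) + (\<i> * of_real (sin t)) \<cdot>\<^sub>m (H * (E j * Q)))" for t
  proof -
    \<comment> \<open>For \<open>j = 1\<close> the left factor is the empty product.\<close>
    have "?C t 1 N = ?C t 1 (j - 1) * ?C t (Suc (j - 1)) N"
      using j by (intro circuit_append V E) auto
    also have "?C t (Suc (j - 1)) N = ?C t j j * ?C t (Suc j) N"
      using j circuit_append[of j N V k E j] V E by auto
    also have "?C t 1 (j - 1) = P" unfolding P_def using j by (intro circuit_cong) auto
    also have "?C t (Suc j) N = Q" unfolding Q_def by (intro circuit_cong) auto
    also have "?C t j j = (of_real (cos t) \<cdot>\<^sub>m 1\<^sub>m ?d + (\<i> * of_real (sin t)) \<cdot>\<^sub>m H) * E j"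
      using layer_eq[of V j k E "\<theta>(j := t)"] V[OF j] Hc Ec
      by (simp add: circuit_layers H_def right_mult_one_mat[of _ ?d ?d])
    also have "\<dots> * Q = (of_real (cos t) \<cdot>\<^sub>m 1\<^sub>m ?d + (\<i> * of_real (sin t)) \<cdot>\<^sub>m H) * (E j * Q)"
      using Hc Ec Qc by (intro assoc_mult_mat[of _ ?d ?d _ ?d _ ?d]) auto
    also have "\<dots> = (of_real (cos t) \<cdot>\<^sub>m 1\<^sub>m ?d) * (E j * Q) + ((\<i> * of_real (sin t)) \<cdot>\<^sub>m H) * (E j * Q)"
      using Hc EQ by (intro add_mult_distrib_mat[of _ ?d ?d _ _ ?d]) auto
    also have "(of_real (cos t) \<cdot>\<^sub>m 1\<^sub>m ?d) * (E j * Q) = of_real (cos t) \<cdot>\<^sub>m (E j * Q)"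
      using EQ by (simp add: mult_smult_assoc_mat[of _ ?d ?d _ ?d] left_mult_one_mat[of _ ?d ?d])
    also have "((\<i> * of_real (sin t)) \<cdot>\<^sub>m H) * (E j * Q) = (\<i> * of_real (sin t)) \<cdot>\<^sub>m (H * (E j * Q))"
      using EQ Hc by (intro mult_smult_assoc_mat[of _ ?d ?d _ ?d])
    finally show ?thesis .
  qed
  have "?C t 1 N $$ (i, s) = of_real (cos t) * (\<Sum>r<?d. P $$ (i, r) * (E j * Q) $$ (r, s))
      + of_real (sin t) * (\<i> * (\<Sum>r<?d. P $$ (i, r) * (H * (E j * Q)) $$ (r, s)))"
    if "i < ?d" "s < ?d" for t i s
  proof -
    have HEQ: "H * (E j * Q) \<in> carrier_mat ?d ?d" using Hc EQ by simp
    have "?C t 1 N $$ (i, s) = (\<Sum>r<?d. P $$ (i, r) *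
      (of_real (cos t) \<cdot>\<^sub>m (E j * Q) + (\<i> * of_real (sin t)) \<cdot>\<^sub>m (H * (E j * Q))) $$ (r, s))"
      unfolding split using Pc EQ HEQ that by (intro mat_mult_index) auto
    also have "\<dots> = (\<Sum>r<?d. of_real (cos t) * (P $$ (i, r) * (E j * Q) $$ (r, s))
        + of_real (sin t) * (\<i> * (P $$ (i, r) * (H * (E j * Q)) $$ (r, s))))"
      by (intro sum.cong refl)
        (use EQ HEQ that in \<open>simp add: algebra_simps del: index_mult_mat\<close>)
    finally show ?thesis by (simp add: sum.distrib sum_distrib_left del: index_mult_mat)
  qed
  then show thesis by (rule that)
qed

section \<open>The cost function in terms of post-measurement amplitudes\<close>

text \<open>The unnormalized post-measurement vector of outcome \<open>i\<close>: the functional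
  <i|U applied to the ancilla factor of \<open>\<Psi>\<close>. The index \<open>r\<close> is the
  flat index of the remaining factor.\<close>

definition branch :: "nat \<Rightarrow> complex vec \<Rightarrow> complex mat \<Rightarrow> nat \<Rightarrow> nat \<Rightarrow> complex" where
  "branch d \<Psi> U i r = (\<Sum>s<d. U $$ (i, s) * \<Psi> $ (r * d + s))"

lemma projected_index:
  assumes U: "U \<in> carrier_mat d d" and "i < d" "s < d" "s' < d"
  shows "(mat_adjoint U * ketbra (unit_vec d i) * U) $$ (s, s') = cnj (U $$ (i, s)) * U $$ (i, s')"
proof -
  have K: "ketbra (unit_vec d i) \<in> carrier_mat d d" by (simp add: ketbra_def)
  have KU: "(ketbra (unit_vec d i) * U) $$ (t, s') = (if t = i then U $$ (i, s') else 0)" if "t < d" for t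
  proof -
    have "(ketbra (unit_vec d i) * U) $$ (t, s') = (\<Sum>t'<d. ketbra (unit_vec d i) $$ (t, t') * U $$ (t', s'))"
      by (rule mat_mult_index[OF K U that assms(4)])
    also have "\<dots> = (\<Sum>t'<d. if t' = i then (if t = i then U $$ (i, s') else 0) else 0)"
      by (intro sum.cong refl) (use assms that in \<open>auto simp: ketbra_def\<close>)
    finally show ?thesis using assms by simp
  qed
  have "(mat_adjoint U * ketbra (unit_vec d i) * U) $$ (s, s') = (mat_adjoint U * (ketbra (unit_vec d i) * U)) $$ (s, s')"
    using U K by (simp add: assoc_mult_mat[of _ d d _ d _ d])
  also have "\<dots> = (\<Sum>t<d. mat_adjoint U $$ (s, t) * (ketbra (unit_vec d i) * U) $$ (t, s'))"
    using U K assms by (intro mat_mult_index) auto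
  also have "\<dots> = (\<Sum>t<d. if t = i then cnj (U $$ (i, s)) * U $$ (i, s') else 0)"
    using U assms by (intro sum.cong refl) (simp add: KU del: index_mult_mat)
  finally show ?thesis using assms by simp
qed

text \<open>The measurement operator is the identity tensored with a rank-one operator, so the image
  of \<open>\<Psi>\<close> factors into an ancilla part and the branch. Written as a sum over
  entries, this serves both the probability and the operator of an outcome.\<close>

lemma meas_op_apply:
  assumes U: "U \<in> carrier_mat d d" and "i < d" and \<Psi>: "dim_vec \<Psi> = n * d" and "r < n" "s < d"
  shows "(\<Sum>c<n * d. meas_op n d U i $$ (r * d + s, c) * \<Psi> $ c) = cnj (U $$ (i, s)) * branch d \<Psi> U i r"
proof -
  have Pc: "mat_adjoint U * ketbra (unit_vec d i) * U \<in> carrier_mat d d" using U by (auto simp: ketbra_def)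
  have "(\<Sum>c<n * d. meas_op n d U i $$ (r * d + s, c) * \<Psi> $ c)
    = (\<Sum>r'<n. \<Sum>s'<d. (if r' = r then cnj (U $$ (i, s)) * (U $$ (i, s') * \<Psi> $ (r * d + s')) else 0))"
    unfolding sum_mult_lessThan meas_op_def
    by (intro sum.cong refl)
      (use assms in \<open>simp add: kron_index_pair[OF one_carrier_mat Pc] projected_index del: index_mult_mat\<close>)
  also have "\<dots> = (\<Sum>r'<n. if r' = r then \<Sum>s'<d. cnj (U $$ (i, s)) * (U $$ (i, s') * \<Psi> $ (r * d + s')) else 0)"
    by (intro sum.cong refl) simp
  finally show ?thesis using assms by (simp add: branch_def sum_distrib_left)
qed

lemma meas_op_carrier [simp]: "U \<in> carrier_mat d d \<Longrightarrow> meas_op n d U i \<in> carrier_mat (n * d) (n * d)"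
  unfolding meas_op_def by (intro kron_carrier one_carrier_mat) (auto simp: ketbra_def)

lemma outcome_prob_eq:
  assumes U: "U \<in> carrier_mat d d" and "i < d" and \<Psi>: "dim_vec \<Psi> = n * d"
  shows "outcome_prob n d \<Psi> U i = (\<Sum>r<n. (cmod (branch d \<Psi> U i r))\<^sup>2)"
proof -
  have "(meas_op n d U i *\<^sub>v \<Psi>) \<bullet>c \<Psi> = (\<Sum>c<n * d. (meas_op n d U i *\<^sub>v \<Psi>) $ c * cnj (\<Psi> $ c))"
    using \<Psi> by (simp add: scalar_prod_def lessThan_atLeast0)
  also have "\<dots> = (\<Sum>c<n * d. (\<Sum>c'<n * d. meas_op n d U i $$ (c, c') * \<Psi> $ c') * cnj (\<Psi> $ c))"
    using \<Psi> meas_op_carrier[OF U, of n i]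
    by (intro sum.cong refl) (simp add: scalar_prod_def lessThan_atLeast0 carrier_matD)
  also have "\<dots> = (\<Sum>r<n. \<Sum>s<d. cnj (U $$ (i, s)) * branch d \<Psi> U i r * cnj (\<Psi> $ (r * d + s)))"
    unfolding sum_mult_lessThan[of _ n d] sum_mult_lessThan[of "\<lambda>c. _ c * cnj (\<Psi> $ c)"]
    by (intro sum.cong refl)
      (use assms in \<open>simp add: meas_op_apply[unfolded sum_mult_lessThan]\<close>)
  also have "\<dots> = (\<Sum>r<n. branch d \<Psi> U i r * cnj (branch d \<Psi> U i r))"
    unfolding branch_def by (simp add: sum_distrib_left sum_distrib_right mult_ac)
  also have "\<dots> = of_real (\<Sum>r<n. (cmod (branch d \<Psi> U i r))\<^sup>2)"
    by (simp only: of_real_sum complex_norm_square)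
  finally show ?thesis by (simp add: outcome_prob_def)
qed

lemma outcome_op_eq:
  assumes U: "U \<in> carrier_mat d d" and "i < d" and \<Psi>: "dim_vec \<Psi> = n * d" and "r < n" "r' < n"
  shows "outcome_op n d \<Psi> U i $$ (r, r') = branch d \<Psi> U i r * cnj (branch d \<Psi> U i r')"
proof -
  have K: "ketbra \<Psi> \<in> carrier_mat (n * d) (n * d)" using \<Psi> by (simp add: ketbra_def)
  have "outcome_op n d \<Psi> U i $$ (r, r') = (\<Sum>s<d. (meas_op n d U i * ketbra \<Psi>) $$ (r * d + s, r' * d + s))"
    using assms by (simp add: outcome_op_def ptrace_snd_def)
  also have "\<dots> = (\<Sum>s<d. (\<Sum>c<n * d. meas_op n d U i $$ (r * d + s, c) * \<Psi> $ c) * cnj (\<Psi> $ (r' * d + s)))"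
  proof (intro sum.cong refl)
    fix s assume s: "s \<in> {..<d}"
    have "(meas_op n d U i * ketbra \<Psi>) $$ (r * d + s, r' * d + s)
      = (\<Sum>c<n * d. meas_op n d U i $$ (r * d + s, c) * ketbra \<Psi> $$ (c, r' * d + s))"
      using s assms by (intro mat_mult_index[of _ "n * d" "n * d" _ "n * d"] meas_op_carrier K mult_add_less) auto
    also have "\<dots> = (\<Sum>c<n * d. meas_op n d U i $$ (r * d + s, c) * \<Psi> $ c * cnj (\<Psi> $ (r' * d + s)))"
      by (intro sum.cong refl) (use s assms in \<open>simp add: ketbra_def mult_add_less\<close>)
    finally show "(meas_op n d U i * ketbra \<Psi>) $$ (r * d + s, r' * d + s)
      = (\<Sum>c<n * d. meas_op n d U i $$ (r * d + s, c) * \<Psi> $ c) * cnj (\<Psi> $ (r' * d + s))"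
      by (simp only: sum_distrib_right)
  qed
  also have "\<dots> = (\<Sum>s<d. cnj (U $$ (i, s)) * branch d \<Psi> U i r * cnj (\<Psi> $ (r' * d + s)))"
    by (intro sum.cong refl) (use assms in \<open>simp add: meas_op_apply\<close>)
  \<comment> \<open>The remaining sum over the ancilla index is the conjugate of the branch at
    \<open>r'\<close>.\<close>
  also have "\<dots> = branch d \<Psi> U i r * cnj (branch d \<Psi> U i r')"
    unfolding branch_def[of d \<Psi> U i r'] by (simp add: sum_distrib_left mult_ac)
  finally show ?thesis .
qed

text \<open>The reduced post-measurement state is the Gram matrix of the branch divided by
  \<open>q\<close>, so the prefactor cancels the normalization of the purity.\<close>

lemma cost_eq:
  assumes U: "U \<in> carrier_mat d d" and \<Psi>: "dim_vec \<Psi> = dA * dB * d"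
  shows "cost dA dB d \<Psi> U = (\<Sum>i<d. amp_entropy dA dB (\<lambda>a b. branch d \<Psi> U i (a * dB + b)))"
  unfolding cost_def Let_def
proof (rule sum.cong[OF refl])
  fix i assume "i \<in> {..<d}"
  then have i: "i < d" by simp
  define x where "x a b = branch d \<Psi> U i (a * dB + b)" for a b
  define q where "q = outcome_prob (dA * dB) d \<Psi> U i"
  have q: "q = amp_norm2 dA dB x"
    unfolding q_def outcome_prob_eq[OF U i \<Psi>] sum_mult_lessThan amp_norm2_def x_def ..
  define X where "X = ptrace_fst dA dB (of_real (1 / q) \<cdot>\<^sub>m outcome_op (dA * dB) d \<Psi> U i)"
  have oc: "outcome_op (dA * dB) d \<Psi> U i \<in> carrier_mat (dA * dB) (dA * dB)"
    by (simp add: outcome_op_def ptrace_snd_def)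
  have Xc: "X \<in> carrier_mat dB dB" by (simp add: X_def ptrace_fst_def)
  have Xb: "X $$ (b, b') = of_real (1 / q) * amp_gram dA x x b b'" if "b < dB" "b' < dB" for b b'
  proof -
    have "X $$ (b, b') = (\<Sum>a<dA. of_real (1 / q) * (x a b * cnj (x a b')))"
      unfolding X_def ptrace_fst_def x_def using that oc
      by (simp add: mult_add_less outcome_op_eq[OF U i \<Psi>])
    then show ?thesis by (simp add: amp_gram_def sum_distrib_left)
  qed
  have "mtrace (X * X) = (\<Sum>b<dB. (X * X) $$ (b, b))"
    using Xc by (simp add: mtrace_def)
  also have "\<dots> = (\<Sum>b<dB. \<Sum>b'<dB. X $$ (b, b') * X $$ (b', b))"
    by (intro sum.cong refl mat_mult_index[OF Xc Xc]) auto
  also have "\<dots> = of_real (\<Sum>b<dB. \<Sum>b'<dB. (1 / q)\<^sup>2 * (cmod (amp_gram dA x x b b'))\<^sup>2)"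
    unfolding of_real_sum
  proof (intro sum.cong refl)
    fix b b' assume b: "b \<in> {..<dB}" "b' \<in> {..<dB}"
    have "amp_gram dA x x b' b = cnj (amp_gram dA x x b b')"
      by (simp add: amp_gram_def mult.commute)
    then have "X $$ (b, b') * X $$ (b', b)
      = (of_real (1 / q))\<^sup>2 * (amp_gram dA x x b b' * cnj (amp_gram dA x x b b'))"
      using b by (simp add: Xb power2_eq_square)
    then show "X $$ (b, b') * X $$ (b', b) = complex_of_real ((1 / q)\<^sup>2 * (cmod (amp_gram dA x x b b'))\<^sup>2)"
      by (simp only: complex_norm_square[symmetric] of_real_mult of_real_power)
  qed
  finally have tr: "Re (mtrace (X * X)) = (1 / q)\<^sup>2 * (\<Sum>b<dB. \<Sum>b'<dB. (cmod (amp_gram dA x x b b'))\<^sup>2)"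
    by (simp add: sum_distrib_left)
  have "q\<^sup>2 * (1 - Re (mtrace (X * X))) = amp_entropy dA dB x"
  proof (cases "q = 0")
    \<comment> \<open>The left side is 0 because of its prefactor; on the right the purity sum is
      squeezed between 0 and \<open>q * q\<close>.\<close>
    case True
    have "(\<Sum>b<dB. \<Sum>b'<dB. (cmod (amp_gram dA x x b b'))\<^sup>2) \<le> 0"
      using amp_gram_bound[of dA x x dB] True q by simp
    moreover have "(\<Sum>b<dB. \<Sum>b'<dB. (cmod (amp_gram dA x x b b'))\<^sup>2) \<ge> 0"
      by (intro sum_nonneg) auto
    ultimately show ?thesis using True by (simp add: amp_entropy_def q[symmetric])
  next
    case False
    then show ?thesis by (simp add: tr amp_entropy_def q[symmetric] field_simps)
  qed
  then show "(outcome_prob (dA * dB) d \<Psi> U i)\<^sup>2 * tsallis2 dA dB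
      (complex_of_real (1 / outcome_prob (dA * dB) d \<Psi> U i) \<cdot>\<^sub>m outcome_op (dA * dB) d \<Psi> U i)
    = amp_entropy dA dB (\<lambda>a b. branch d \<Psi> U i (a * dB + b))"
    unfolding tsallis2_def X_def q_def x_def .
qed

lemma branch_total_weight:
  assumes U: "U \<in> unitary_group d"
  shows "(\<Sum>i<d. \<Sum>r<n. (cmod (branch d \<Psi> U i r))\<^sup>2) = (\<Sum>r<n. \<Sum>s<d. (cmod (\<Psi> $ (r * d + s)))\<^sup>2)"
  unfolding branch_def
  by (subst sum.swap) (simp only: unitary_group_norm_preserving[OF U])

lemma purification_norm:
  assumes "pure_ensemble n d p \<psi> \<rho>"
  shows "(\<Sum>r<n. \<Sum>s<d. (cmod (purification n d p \<psi> $ (r * d + s)))\<^sup>2) = 1"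
proof -
  have p0: "\<And>s. s < d \<Longrightarrow> p s \<ge> 0" and p1: "(\<Sum>s<d. p s) = 1"
    and \<psi>: "\<And>s. s < d \<Longrightarrow> dim_vec (\<psi> s) = n" "\<And>s. s < d \<Longrightarrow> \<psi> s \<bullet>c \<psi> s = 1"
    using assms by (auto simp: pure_ensemble_def)
  have entry: "purification n d p \<psi> $ (r * d + s) = of_real (sqrt (p s)) * \<psi> s $ r"
    if "r < n" "s < d" for r s
  proof -
    have "purification n d p \<psi> $ (r * d + s)
      = (\<Sum>i<d. of_real (sqrt (p i)) * kron_vec (\<psi> i) (unit_vec d i) $ (r * d + s))"
      using that by (simp add: purification_def mult_add_less)
    also have "\<dots> = (\<Sum>i<d. if i = s then of_real (sqrt (p s)) * \<psi> s $ r else 0)"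
      by (intro sum.cong refl) (use that in \<open>auto simp: kron_vec_def \<psi> mult_add_less\<close>)
    finally show ?thesis using that by simp
  qed
  have norm: "(\<Sum>r<n. (cmod (\<psi> s $ r))\<^sup>2) = 1" if "s < d" for s
  proof -
    have "complex_of_real (\<Sum>r<n. (cmod (\<psi> s $ r))\<^sup>2) = \<psi> s \<bullet>c \<psi> s"
      unfolding of_real_sum complex_norm_square
      using \<psi>(1)[OF that] by (simp add: scalar_prod_def lessThan_atLeast0)
    then show ?thesis using \<psi>(2)[OF that] by (simp only: of_real_eq_1_iff)
  qed
  have "(\<Sum>r<n. \<Sum>s<d. (cmod (purification n d p \<psi> $ (r * d + s)))\<^sup>2)
    = (\<Sum>r<n. \<Sum>s<d. p s * (cmod (\<psi> s $ r))\<^sup>2)"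
    by (intro sum.cong refl) (simp add: entry norm_mult power_mult_distrib p0)
  also have "\<dots> = (\<Sum>s<d. p s * (\<Sum>r<n. (cmod (\<psi> s $ r))\<^sup>2))"
    by (subst sum.swap) (simp only: sum_distrib_left)
  also have "\<dots> = 1" using p1 by (simp add: norm)
  finally show ?thesis .
qed

lemma cost_deriv_bound:
  assumes V: "\<And>l. l \<in> {1..N} \<Longrightarrow> length (V l) = k"
    and E: "\<And>l. l \<in> {1..N} \<Longrightarrow> E l \<in> unitary_group (2 ^ k)" and j: "j \<in> {1..N}"
    and dim: "dim_vec \<Psi> = dA * dB * 2 ^ k"
    and norm: "(\<Sum>r<dA * dB. \<Sum>s<2 ^ k. (cmod (\<Psi> $ (r * 2 ^ k + s)))\<^sup>2) = 1"
  shows "(cost_deriv dA dB (2 ^ k) \<Psi> N E j (\<theta>, V))\<^sup>2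
    \<le> 64 * (\<Sum>i<2 ^ k. (\<Sum>r<dA * dB. (cmod (branch (2 ^ k) \<Psi> (circuit (2 ^ k) E V \<theta> 1 N) i r))\<^sup>2)\<^sup>2)"
proof -
  let ?d = "2 ^ k :: nat"
  define U where "U t = circuit ?d E V (\<theta>(j := t)) 1 N" for t
  have Uu: "U t \<in> unitary_group ?d" for t
    unfolding U_def using V E by (intro circuit_unitary) auto
  have Uc: "U t \<in> carrier_mat ?d ?d" for t using Uu by (rule unitary_groupD)
  obtain A B where AB: "\<And>t i s. i < ?d \<Longrightarrow> s < ?d \<Longrightarrow>
      U t $$ (i, s) = of_real (cos t) * A i s + of_real (sin t) * B i s"
    unfolding U_def by (rule circuit_one_angle[OF V E j]) blast+
  define x where "x t i a b = branch ?d \<Psi> (U t) i (a * dB + b)" for t i a b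
  have xAB: "x t i a b = of_real (cos t) * (\<Sum>s<?d. A i s * \<Psi> $ ((a * dB + b) * ?d + s))
      + of_real (sin t) * (\<Sum>s<?d. B i s * \<Psi> $ ((a * dB + b) * ?d + s))" if "i < ?d" for t i a b
    unfolding x_def branch_def sum_distrib_left sum.distrib[symmetric]
    by (intro sum.cong refl) (use that in \<open>simp add: AB algebra_simps\<close>)
  \<comment> \<open>A quarter turn sends (cos, sin) to (- sin, cos), so the derivative of each
    amplitude is an amplitude of the circuit at the shifted angle.\<close>
  have dx: "((\<lambda>t. x t i a b) has_vector_derivative x (t + pi / 2) i a b) (at t)" if "i < ?d" for t i a b
  proof -
    have "((\<lambda>t. of_real (cos t) * u + of_real (sin t) * v) has_vector_derivative
      of_real (cos (t + pi / 2)) * u + of_real (sin (t + pi / 2)) * v) (at t)" for u v :: complex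
    proof -
      have "((\<lambda>t. of_real (cos t) * u + of_real (sin t) * v) has_vector_derivative
        of_real (- sin t) * u + of_real (cos t) * v) (at t)"
        by (intro has_vector_derivative_add has_vector_derivative_mult_left has_vector_derivative_of_real)
          (auto intro!: derivative_eq_intros)
      then show ?thesis by (simp add: cos_add sin_add)
    qed
    then show ?thesis using that by (simp add: xAB)
  qed
  define q where "q t i = amp_norm2 dA dB (x t i)" for t i
  have q_eq: "q t i = (\<Sum>r<dA * dB. (cmod (branch ?d \<Psi> (U t) i r))\<^sup>2)" for t i
    unfolding q_def amp_norm2_def x_def sum_mult_lessThan ..
  \<comment> \<open>This holds at every angle, and therefore also for the weights of the derivative,
    taken at \<open>t + pi / 2\<close>.\<close>
  have q_sum: "(\<Sum>i<?d. q t i) = 1" for t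
    unfolding q_eq branch_total_weight[OF Uu] by (rule norm)
  define t where "t = \<theta> j"
  have "\<exists>D. \<forall>i<?d. ((\<lambda>t. amp_entropy dA dB (x t i)) has_real_derivative D i) (at t)
      \<and> \<bar>D i\<bar> \<le> 8 * (q t i * sqrt (q t i * q (t + pi / 2) i))"
  proof -
    have "\<exists>D. i < ?d \<longrightarrow> ((\<lambda>t. amp_entropy dA dB (x t i)) has_real_derivative D) (at t)
      \<and> \<bar>D\<bar> \<le> 8 * (q t i * sqrt (q t i * q (t + pi / 2) i))" for i
      unfolding q_def using amp_entropy_derivative[of dA dB "\<lambda>t. x t i" "x (t + pi / 2) i" t] dx[of i]
      by metis
    then show ?thesis by metis
  qed
  then obtain D where D: "\<And>i. i < ?d \<Longrightarrow> ((\<lambda>t. amp_entropy dA dB (x t i)) has_real_derivative D i) (at t)"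
    "\<And>i. i < ?d \<Longrightarrow> \<bar>D i\<bar> \<le> 8 * (q t i * sqrt (q t i * q (t + pi / 2) i))" by blast
  have "((\<lambda>t. \<Sum>i<?d. amp_entropy dA dB (x t i)) has_real_derivative (\<Sum>i<?d. D i)) (at t)"
    by (intro DERIV_sum D) simp
  then have "deriv (\<lambda>t. cost dA dB ?d \<Psi> (U t)) t = (\<Sum>i<?d. D i)"
    unfolding cost_eq[OF Uc dim] x_def by (rule DERIV_imp_deriv)
  then have "cost_deriv dA dB ?d \<Psi> N E j (\<theta>, V) = (\<Sum>i<?d. D i)"
    by (simp add: cost_deriv_def U_def t_def)
  moreover have "\<bar>\<Sum>i<?d. D i\<bar> \<le> 8 * (\<Sum>i<?d. q t i * sqrt (q t i * q (t + pi / 2) i))"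
    unfolding sum_distrib_left by (rule order_trans[OF sum_abs]) (auto intro!: sum_mono D)
  ultimately have "\<bar>cost_deriv dA dB ?d \<Psi> N E j (\<theta>, V)\<bar>\<^sup>2
    \<le> (8 * (\<Sum>i<?d. q t i * sqrt (q t i * q (t + pi / 2) i)))\<^sup>2"
    by (intro power_mono) auto
  also have "\<dots> = 64 * (\<Sum>i<?d. q t i * sqrt (q t i * q (t + pi / 2) i))\<^sup>2"
    by (simp only: power_mult_distrib) simp
  also have "\<dots> \<le> 64 * (\<Sum>i<?d. (q t i)\<^sup>2)"
    using q_sum by (intro mult_left_mono sum_weighted_sqrt_bound) (auto simp: q_def amp_norm2_nonneg)
  finally show ?thesis by (simp add: q_eq U_def t_def)
qed

section \<open>Hadamard matrices with random signs\<close>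

text \<open>Its tensor powers are unitary with all entries of equal modulus, so every row spreads
  weight evenly over the \<open>2 ^ k\<close> coordinates.\<close>

definition hadamard :: "complex mat" where
  "hadamard = mat 2 2 (\<lambda>(r, c). of_real (1 / sqrt 2) * (if r = 1 \<and> c = 1 then - 1 else 1))"

lemma hadamard_unitary: "hadamard \<in> unitary_group 2"
proof -
  have c: "hadamard \<in> carrier_mat 2 2" by (simp add: hadamard_def)
  have adj: "mat_adjoint hadamard = hadamard"
  proof (rule eq_matI)
    fix i j assume "i < dim_row hadamard" "j < dim_col hadamard"
    then have "i < 2" "j < 2" using c by auto
    then show "mat_adjoint hadamard $$ (i, j) = hadamard $$ (i, j)"
      using c by (subst mat_adjoint_index) (auto simp: hadamard_def)
  qed (use c in auto)
  have half: "complex_of_real (1 / sqrt 2) * complex_of_real (1 / sqrt 2) = 1 / 2"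
    by (simp flip: of_real_mult)
  have "hadamard * hadamard = 1\<^sub>m 2"
  proof (rule eq_matI)
    fix i j assume "i < dim_row (1\<^sub>m 2 :: complex mat)" "j < dim_col (1\<^sub>m 2 :: complex mat)"
    then have ij: "i < 2" "j < 2" by auto
    have "(hadamard * hadamard) $$ (i, j) = (\<Sum>l<2. hadamard $$ (i, l) * hadamard $$ (l, j))"
      by (rule mat_mult_index[OF c c ij])
    also have "\<dots> = hadamard $$ (i, 0) * hadamard $$ (0, j) + hadamard $$ (i, 1) * hadamard $$ (1, j)"
      by (simp add: numeral_2_eq_2)
    also have "\<dots> = 1\<^sub>m 2 $$ (i, j)"
      using ij half unfolding less_2_cases_iff by (auto simp: hadamard_def)
    finally show "(hadamard * hadamard) $$ (i, j) = 1\<^sub>m 2 $$ (i, j)" .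
  qed (use c in auto)
  then show ?thesis using c adj by (simp add: unitary_group_def)
qed

lemma kron_pow_unitary: "U \<in> unitary_group d \<Longrightarrow> kron_pow l U \<in> unitary_group (d ^ l)"
  by (induction l) (auto intro: unitary_group_kron)

lemma hadamard_pow_entry:
  "r < 2 ^ k \<Longrightarrow> c < 2 ^ k \<Longrightarrow> (cmod (kron_pow k hadamard $$ (r, c)))\<^sup>2 = 1 / 2 ^ k"
proof (induction k arbitrary: r c)
  case (Suc k)
  have H: "hadamard \<in> carrier_mat 2 2" by (simp add: hadamard_def)
  have K: "kron_pow k hadamard \<in> carrier_mat (2 ^ k) (2 ^ k)"
    using kron_pow_unitary[OF hadamard_unitary, of k] by (rule unitary_groupD)
  have rc: "r < 2 * 2 ^ k" "c < 2 * 2 ^ k" using Suc.prems by auto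
  have H2: "(cmod (hadamard $$ (a, b)))\<^sup>2 = 1 / 2" if "a < 2" "b < 2" for a b
    using that by (auto simp: hadamard_def norm_mult norm_divide power_mult_distrib power_divide)
  show ?case
    by (simp only: power_Suc kron_pow.simps kron_index[OF H K rc] norm_mult power_mult_distrib
      Suc.IH[OF mod_less_of_less_mult[OF rc(1)] mod_less_of_less_mult[OF rc(2)]]
      H2[OF div_less_of_less_mult[OF rc(1)] div_less_of_less_mult[OF rc(2)]])
qed simp

definition sign_mat :: "nat \<Rightarrow> nat set \<Rightarrow> complex mat" where
  "sign_mat d T = mat d d (\<lambda>(r, c). if r = c then sgn_flip T r else 0)"

lemma sign_mat_unitary: "sign_mat d T \<in> unitary_group d"
proof -
  have c: "sign_mat d T \<in> carrier_mat d d" by (simp add: sign_mat_def)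
  have adj: "mat_adjoint (sign_mat d T) = sign_mat d T"
    by (rule eq_matI) (auto simp: sign_mat_def sgn_flip_def)
  have "sign_mat d T * sign_mat d T = 1\<^sub>m d"
  proof (rule eq_matI)
    fix i j assume "i < dim_row (1\<^sub>m d :: complex mat)" "j < dim_col (1\<^sub>m d :: complex mat)"
    then have ij: "i < d" "j < d" by auto
    have "(sign_mat d T * sign_mat d T) $$ (i, j) = (\<Sum>l<d. sign_mat d T $$ (i, l) * sign_mat d T $$ (l, j))"
      by (rule mat_mult_index[OF c c ij])
    also have "\<dots> = (\<Sum>l<d. if l = i then (if i = j then 1 else 0) else 0)"
      by (intro sum.cong refl) (use ij in \<open>auto simp: sign_mat_def sgn_flip_def\<close>)
    also have "\<dots> = 1\<^sub>m d $$ (i, j)" using ij by simp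
    finally show "(sign_mat d T * sign_mat d T) $$ (i, j) = 1\<^sub>m d $$ (i, j)" .
  qed (use c in auto)
  then show ?thesis using c adj by (simp add: unitary_group_def)
qed

lemma mat_mult_vec_sum:
  fixes A B :: "complex mat"
  assumes "A \<in> carrier_mat d d" "B \<in> carrier_mat d d" "i < d"
  shows "(\<Sum>s<d. (A * B) $$ (i, s) * v s) = (\<Sum>r<d. A $$ (i, r) * (\<Sum>s<d. B $$ (r, s) * v s))"
proof -
  have "(\<Sum>s<d. (A * B) $$ (i, s) * v s) = (\<Sum>s<d. \<Sum>r<d. A $$ (i, r) * B $$ (r, s) * v s)"
    by (intro sum.cong refl)
      (use assms in \<open>simp add: mat_mult_index[OF assms(1,2)] sum_distrib_right del: index_mult_mat\<close>)
  also have "\<dots> = (\<Sum>r<d. \<Sum>s<d. A $$ (i, r) * B $$ (r, s) * v s)" by (rule sum.swap)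
  finally show ?thesis by (simp add: sum_distrib_left mult.assoc)
qed

text \<open>With x = U v, row \<open>i\<close> of the product applied to \<open>v\<close> is a
  signed sum with coefficients F(i,r) x(r). The entries of F have squared modulus
  \<open>1 / 2 ^ k\<close> and \<open>U\<close> preserves norms, which fixes the total weight in
  Khintchine's inequality. The factor \<open>2 ^ 2 ^ k\<close> counts the sign patterns.\<close>

lemma random_sign_fourth_moment:
  assumes "i < 2 ^ k" "U \<in> unitary_group (2 ^ k)"
  shows "(\<Sum>T\<in>Pow {..<2 ^ k}. (cmod (\<Sum>s<2 ^ k. (kron_pow k hadamard * sign_mat (2 ^ k) T * U) $$ (i, s) * v s)) ^ 4)
    \<le> 2 ^ 2 ^ k * (3 * (\<Sum>s<2 ^ k. (cmod (v s))\<^sup>2)\<^sup>2 / (2 ^ k)\<^sup>2)"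
proof -
  let ?d = "2 ^ k :: nat" and ?F = "kron_pow k hadamard"
  have F: "?F \<in> carrier_mat ?d ?d"
    using kron_pow_unitary[OF hadamard_unitary, of k] by (rule unitary_groupD)
  have S: "sign_mat ?d T \<in> carrier_mat ?d ?d" for T by (simp add: sign_mat_def)
  have U: "U \<in> carrier_mat ?d ?d" using assms by (auto dest: unitary_groupD)
  define x where "x r = (\<Sum>s<?d. U $$ (r, s) * v s)" for r
  have entry: "(\<Sum>s<?d. (?F * sign_mat ?d T * U) $$ (i, s) * v s) = (\<Sum>r<?d. sgn_flip T r * (?F $$ (i, r) * x r))" for T
  proof -
    have "(\<Sum>s<?d. (?F * sign_mat ?d T * U) $$ (i, s) * v s)
      = (\<Sum>r<?d. ?F $$ (i, r) * (\<Sum>s<?d. sign_mat ?d T $$ (r, s) * x s))"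
      unfolding x_def using F S U assms
      by (simp only: mat_mult_vec_sum[OF mult_carrier_mat[OF F S] U assms(1)] mat_mult_vec_sum[OF F S assms(1)])
    also have "\<dots> = (\<Sum>r<?d. ?F $$ (i, r) * (\<Sum>s<?d. if s = r then sgn_flip T r * x r else 0))"
      by (intro sum.cong arg_cong2[where f = "(*)"] refl) (auto simp: sign_mat_def)
    also have "\<dots> = (\<Sum>r<?d. sgn_flip T r * (?F $$ (i, r) * x r))"
      by (intro sum.cong refl) simp
    finally show ?thesis .
  qed
  have "(\<Sum>r<?d. (cmod (?F $$ (i, r) * x r))\<^sup>2) = (\<Sum>r<?d. (1 / 2 ^ k) * (cmod (x r))\<^sup>2)"
    by (intro sum.cong refl)
      (use assms in \<open>simp add: norm_mult power_mult_distrib hadamard_pow_entry\<close>)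
  also have "\<dots> = (\<Sum>s<?d. (cmod (v s))\<^sup>2) / 2 ^ k"
    unfolding sum_distrib_left[symmetric] x_def unitary_group_norm_preserving[OF assms(2)] by simp
  finally show ?thesis
    using Khintchine_fourth_moment[of "{..<?d}" "\<lambda>r. ?F $$ (i, r) * x r"]
    by (simp add: entry power_divide)
qed

section \<open>Fourth moments of Haar measure and of designs\<close>

lemma space_unitary_borel [simp]: "space (unitary_borel d) = unitary_group d"
  by (simp add: unitary_borel_def)

lemma measurable_unitary_entry [measurable]:
  assumes "i < d" "s < d"
  shows "(\<lambda>U. U $$ (i, s)) \<in> borel_measurable (unitary_borel d)"
proof -
  have "(\<lambda>U. \<lambda>rc\<in>{..<d} \<times> {..<d}. U $$ rc) \<in> measurable (unitary_borel d) (\<Pi>\<^sub>M rc\<in>{..<d} \<times> {..<d}. (borel :: complex measure))"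
    unfolding unitary_borel_def by (rule measurable_vimage_algebra1) (auto simp: space_PiM)
  from measurable_compose[OF this measurable_component_singleton[of "(i, s)"]] show ?thesis
    using assms by simp
qed

text \<open>The Borel structure is induced by the entries, so measurability is checked entry by
  entry.\<close>

lemma measurable_unitary_borelI:
  assumes "\<And>x. x \<in> space N \<Longrightarrow> g x \<in> unitary_group d"
    and "\<And>i s. i < d \<Longrightarrow> s < d \<Longrightarrow> (\<lambda>x. g x $$ (i, s)) \<in> borel_measurable N"
  shows "g \<in> measurable N (unitary_borel d)"
  unfolding unitary_borel_def
  by (rule measurable_vimage_algebra2) (use assms in \<open>auto intro!: measurable_restrict\<close>)

lemma measurable_unitary_mult:
  assumes f: "f \<in> measurable N (unitary_borel d)" and g: "g \<in> measurable N (unitary_borel d)"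
  shows "(\<lambda>x. f x * g x) \<in> measurable N (unitary_borel d)"
proof (rule measurable_unitary_borelI)
  have fu: "f x \<in> unitary_group d" "g x \<in> unitary_group d" if "x \<in> space N" for x
    using measurable_space[OF f that] measurable_space[OF g that] by simp_all
  show "f x * g x \<in> unitary_group d" if "x \<in> space N" for x
    using fu[OF that] by (rule unitary_group_mult)
  fix i s assume lt: "i < d" "s < d"
  have "(\<lambda>x. \<Sum>r<d. f x $$ (i, r) * g x $$ (r, s)) \<in> borel_measurable N"
    using lt by (intro borel_measurable_sum borel_measurable_times
      measurable_compose[OF f measurable_unitary_entry] measurable_compose[OF g measurable_unitary_entry]) auto
  then show "(\<lambda>x. (f x * g x) $$ (i, s)) \<in> borel_measurable N"
    by (rule measurable_cong[THEN iffD2, rotated])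
      (use lt fu in \<open>auto intro!: mat_mult_index unitary_groupD(1)\<close>)
qed

definition row_moment :: "nat \<Rightarrow> (nat \<Rightarrow> complex) \<Rightarrow> complex mat \<Rightarrow> nat \<Rightarrow> real" where
  "row_moment d v W i = (cmod (\<Sum>s<d. W $$ (i, s) * v s)) ^ 4"

lemma row_moment_measurable:
  "i < d \<Longrightarrow> (\<lambda>W. row_moment d v W i) \<in> borel_measurable (unitary_borel d)"
  unfolding row_moment_def
  by (intro borel_measurable_power borel_measurable_norm borel_measurable_sum borel_measurable_times
    measurable_unitary_entry) auto

lemma row_moment_bounds:
  assumes "W \<in> unitary_group d" "i < d"
  shows "0 \<le> row_moment d v W i" "row_moment d v W i \<le> (\<Sum>s<d. (cmod (v s))\<^sup>2)\<^sup>2"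
proof -
  have "(cmod (\<Sum>s<d. W $$ (i, s) * v s))\<^sup>2 \<le> (\<Sum>i<d. (cmod (\<Sum>s<d. W $$ (i, s) * v s))\<^sup>2)"
    using assms by (intro member_le_sum) auto
  also have "\<dots> = (\<Sum>s<d. (cmod (v s))\<^sup>2)" by (rule unitary_group_norm_preserving[OF assms(1)])
  finally have "((cmod (\<Sum>s<d. W $$ (i, s) * v s))\<^sup>2)\<^sup>2 \<le> (\<Sum>s<d. (cmod (v s))\<^sup>2)\<^sup>2"
    by (intro power_mono) auto
  then show "row_moment d v W i \<le> (\<Sum>s<d. (cmod (v s))\<^sup>2)\<^sup>2" by (simp add: row_moment_def flip: power_mult)
qed (simp add: row_moment_def)

lemma integrable_row_moment:
  assumes "prob_space N" and g: "g \<in> measurable N (unitary_borel d)" and "i < d"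
  shows "integrable N (\<lambda>x. row_moment d v (g x) i)"
proof -
  interpret prob_space N by fact
  show ?thesis
  proof (rule integrable_const_bound)
    show "AE x in N. norm (row_moment d v (g x) i) \<le> (\<Sum>s<d. (cmod (v s))\<^sup>2)\<^sup>2"
      using measurable_space[OF g] row_moment_bounds[of _ d i v] assms(3) by (intro AE_I2) auto
    show "(\<lambda>x. row_moment d v (g x) i) \<in> borel_measurable N"
      using measurable_compose[OF g row_moment_measurable[OF assms(3)]] .
  qed
qed

text \<open>Left invariance replaces \<open>L\<close> by any \<open>W T\<close>; the sum over
  \<open>T\<close> is then taken inside the integral, where the bound holds for every single
  \<open>U\<close>.\<close>

lemma haar_fourth_moment:
  assumes \<mu>: "is_haar (2 ^ k) \<mu>" and L: "L \<in> unitary_group (2 ^ k)" and i: "i < 2 ^ k"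
  shows "(\<integral>U. row_moment (2 ^ k) v (L * U) i \<partial>\<mu>) \<le> 3 * (\<Sum>s<2 ^ k. (cmod (v s))\<^sup>2)\<^sup>2 / (2 ^ k)\<^sup>2"
proof -
  let ?d = "2 ^ k :: nat"
  let ?B = "3 * (\<Sum>s<?d. (cmod (v s))\<^sup>2)\<^sup>2 / (2 ^ k)\<^sup>2"
  interpret prob_space \<mu> using \<mu> by (simp add: is_haar_def)
  have sets: "sets \<mu> = sets (unitary_borel ?d)" using \<mu> by (simp add: is_haar_def)
  then have space: "space \<mu> = unitary_group ?d" by (metis sets_eq_imp_space_eq space_unitary_borel)
  have id: "(\<lambda>U. U) \<in> measurable \<mu> (unitary_borel ?d)"
    by (simp add: measurable_ident_sets[OF sets])
  define W where "W T = kron_pow k hadamard * sign_mat ?d T" for T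
  have Wu: "W T \<in> unitary_group ?d" for T
    unfolding W_def by (intro unitary_group_mult kron_pow_unitary hadamard_unitary sign_mat_unitary)
  have mult: "(\<lambda>U. A * U) \<in> measurable \<mu> (unitary_borel ?d)" if "A \<in> unitary_group ?d" for A
    using that by (intro measurable_unitary_mult id) auto
  have inv: "(\<integral>U. row_moment ?d v (L * U) i \<partial>\<mu>) = (\<integral>U. row_moment ?d v (W T * U) i \<partial>\<mu>)" for T
  proof -
    \<comment> \<open>The translation is chosen so that \<open>L * A = W T\<close>.\<close>
    define A where "A = mat_adjoint L * W T"
    have A: "A \<in> unitary_group ?d"
      unfolding A_def by (intro unitary_group_mult unitary_group_adjoint L Wu)
    have "(\<integral>U. row_moment ?d v (L * U) i \<partial>\<mu>) = (\<integral>U. row_moment ?d v (L * U) i \<partial>distr \<mu> \<mu> (\<lambda>U. A * U))"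
      using \<mu> A by (simp add: is_haar_def)
    also have "\<dots> = (\<integral>U. row_moment ?d v (L * (A * U)) i \<partial>\<mu>)"
    proof (rule integral_distr)
      show "(\<lambda>U. A * U) \<in> measurable \<mu> \<mu>"
        using mult[OF A] by (simp add: measurable_cong_sets[OF refl sets])
      show "(\<lambda>U. row_moment ?d v (L * U) i) \<in> borel_measurable \<mu>"
        by (rule measurable_compose[OF mult[OF L] row_moment_measurable[OF i]])
    qed
    also have "\<dots> = (\<integral>U. row_moment ?d v (W T * U) i \<partial>\<mu>)"
    proof (rule Bochner_Integration.integral_cong[OF refl])
      fix U assume "U \<in> space \<mu>"
      then have U: "U \<in> carrier_mat ?d ?d" using space by (auto dest: unitary_groupD)
      note c = unitary_groupD(1)[OF L] unitary_groupD(1)[OF Wu[of T]] mat_adjoint_carrier[OF unitary_groupD(1)[OF L]]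
      have "L * (A * U) = (L * A) * U"
        using c U unitary_groupD(1)[OF A] by (intro assoc_mult_mat[symmetric])
      also have "L * A = (L * mat_adjoint L) * W T"
        unfolding A_def using c by (intro assoc_mult_mat[symmetric])
      also have "\<dots> = W T" using c unitary_groupD(3)[OF L] by simp
      finally show "row_moment ?d v (L * (A * U)) i = row_moment ?d v (W T * U) i" by simp
    qed
    finally show ?thesis .
  qed
  have int: "integrable \<mu> (\<lambda>U. row_moment ?d v (W T * U) i)" for T
    by (rule integrable_row_moment[OF prob_space_axioms mult[OF Wu] i])
  \<comment> \<open>The integral with \<open>L\<close> is free of \<open>T\<close>, so it is summed
    once for each of the \<open>2 ^ ?d\<close> sign patterns.\<close>
  have "2 ^ ?d * (\<integral>U. row_moment ?d v (L * U) i \<partial>\<mu>) = (\<Sum>T\<in>Pow {..<?d}. \<integral>U. row_moment ?d v (L * U) i \<partial>\<mu>)"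
    by (simp add: card_Pow)
  also have "\<dots> = (\<Sum>T\<in>Pow {..<?d}. \<integral>U. row_moment ?d v (W T * U) i \<partial>\<mu>)"
    by (intro sum.cong refl inv)
  also have "\<dots> = (\<integral>U. (\<Sum>T\<in>Pow {..<?d}. row_moment ?d v (W T * U) i) \<partial>\<mu>)"
    by (rule Bochner_Integration.integral_sum[symmetric]) (rule int)
  also have "\<dots> \<le> 2 ^ ?d * ?B"
  proof (rule integral_le_const)
    show "integrable \<mu> (\<lambda>U. \<Sum>T\<in>Pow {..<?d}. row_moment ?d v (W T * U) i)"
      by (intro Bochner_Integration.integrable_sum int)
    show "AE U in \<mu>. (\<Sum>T\<in>Pow {..<?d}. row_moment ?d v (W T * U) i) \<le> 2 ^ ?d * ?B"
      using random_sign_fourth_moment[OF i, of _ v] by (intro AE_I2) (simp add: space row_moment_def W_def)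
  qed
  finally show ?thesis by (rule mult_left_le_imp_le) simp
qed

section \<open>Transfer from Haar measure to designs\<close>

lemma kron_pow_2_index:
  assumes A: "A \<in> carrier_mat d d" and "r < d" "r' < d" "c < d" "c' < d"
  shows "kron_pow 2 A $$ (r * d + r', c * d + c') = A $$ (r, c) * A $$ (r', c')"
proof -
  \<comment> \<open>The recursion of \<open>kron_pow\<close> ends with a factor
    \<open>1\<^sub>m 1\<close>, which has to be stripped from the inner copy of
    \<open>A\<close>.\<close>
  have A1: "kron A (1\<^sub>m 1) \<in> carrier_mat d d" using kron_carrier[OF A one_carrier_mat[of 1]] by simp
  have "kron A (1\<^sub>m 1) $$ (r', c') = A $$ (r', c')"
    using kron_index_pair[OF A one_carrier_mat[of 1], of r' 0 c' 0] assms by simp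
  then show ?thesis
    using kron_index_pair[OF A A1 assms(2,3,4,5)] by (simp add: numeral_2_eq_2)
qed

text \<open>The design condition at \<open>l = 2\<close> equates two averaged matrices, whose
  entries are exactly the moments of bidegree (2,2).\<close>

lemma unitary_design_monomials:
  assumes P: "unitary_design t d P" and t: "2 \<le> t"
  obtains \<mu> where "is_haar d \<mu>"
    "\<And>r1 c1 r2 c2 r3 c3 r4 c4. \<lbrakk>r1 < d; c1 < d; r2 < d; c2 < d; r3 < d; c3 < d; r4 < d; c4 < d\<rbrakk> \<Longrightarrow>
      (\<integral>U. U $$ (r1, c1) * U $$ (r2, c2) * cnj (U $$ (r3, c3)) * cnj (U $$ (r4, c4)) \<partial>P)
      = (\<integral>U. U $$ (r1, c1) * U $$ (r2, c2) * cnj (U $$ (r3, c3)) * cnj (U $$ (r4, c4)) \<partial>\<mu>)"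
proof -
  let ?F = "\<lambda>U. kron (kron_pow 2 U) (kron_pow 2 (mat_adjoint U))"
  obtain \<mu> where \<mu>: "is_haar d \<mu>"
    and eq: "mat_integral (d ^ 2 * d ^ 2) P ?F = mat_integral (d ^ 2 * d ^ 2) \<mu> ?F"
    using P t unfolding unitary_design_def by blast
  have space: "space P = unitary_group d" "space \<mu> = unitary_group d"
    using P \<mu> unfolding unitary_design_def is_haar_def by (metis sets_eq_imp_space_eq space_unitary_borel)+
  show thesis
  proof (rule that[OF \<mu>])
    fix r1 c1 r2 c2 r3 c3 r4 c4
    assume lt: "r1 < d" "c1 < d" "r2 < d" "c2 < d" "r3 < d" "c3 < d" "r4 < d" "c4 < d"
    \<comment> \<open>The adjoint transposes: in the second Kronecker factor \<open>c3\<close> and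
      \<open>c4\<close> form the row index, \<open>r3\<close> and \<open>r4\<close> the column
      index.\<close>
    let ?a = "r1 * d + r2" and ?b = "c1 * d + c2" and ?a' = "c3 * d + c4" and ?b' = "r3 * d + r4"
    have ab: "?a < d\<^sup>2" "?b < d\<^sup>2" "?a' < d\<^sup>2" "?b' < d\<^sup>2"
      unfolding power2_eq_square using lt by (auto intro: mult_add_less)
    have entry: "?F U $$ (?a * d\<^sup>2 + ?a', ?b * d\<^sup>2 + ?b')
      = U $$ (r1, c1) * U $$ (r2, c2) * cnj (U $$ (r3, c3)) * cnj (U $$ (r4, c4))"
      if "U \<in> unitary_group d" for U
    proof -
      have U: "U \<in> carrier_mat d d" and U': "mat_adjoint U \<in> carrier_mat d d"
        using unitary_groupD(1)[OF that] by auto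
      have K: "kron_pow 2 U \<in> carrier_mat (d\<^sup>2) (d\<^sup>2)" "kron_pow 2 (mat_adjoint U) \<in> carrier_mat (d\<^sup>2) (d\<^sup>2)"
        using that by (blast intro: unitary_groupD kron_pow_unitary unitary_group_adjoint)+
      show ?thesis
        using U lt
        by (simp only: kron_index_pair[OF K ab(1,3,2,4)] kron_pow_2_index[OF U] kron_pow_2_index[OF U'])
          (simp add: mult.assoc)
    qed
    have "mat_integral (d ^ 2 * d ^ 2) P ?F $$ (?a * d\<^sup>2 + ?a', ?b * d\<^sup>2 + ?b')
      = mat_integral (d ^ 2 * d ^ 2) \<mu> ?F $$ (?a * d\<^sup>2 + ?a', ?b * d\<^sup>2 + ?b')"
      by (simp only: eq)
    then have "(\<integral>U. ?F U $$ (?a * d\<^sup>2 + ?a', ?b * d\<^sup>2 + ?b') \<partial>P) = (\<integral>U. ?F U $$ (?a * d\<^sup>2 + ?a', ?b * d\<^sup>2 + ?b') \<partial>\<mu>)"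
      using mult_add_less[OF ab(1,3)] mult_add_less[OF ab(2,4)] by (simp add: mat_integral_def)
    also have "(\<integral>U. ?F U $$ (?a * d\<^sup>2 + ?a', ?b * d\<^sup>2 + ?b') \<partial>P)
      = (\<integral>U. U $$ (r1, c1) * U $$ (r2, c2) * cnj (U $$ (r3, c3)) * cnj (U $$ (r4, c4)) \<partial>P)"
      by (rule Bochner_Integration.integral_cong[OF refl entry]) (simp add: space)
    also have "(\<integral>U. ?F U $$ (?a * d\<^sup>2 + ?a', ?b * d\<^sup>2 + ?b') \<partial>\<mu>)
      = (\<integral>U. U $$ (r1, c1) * U $$ (r2, c2) * cnj (U $$ (r3, c3)) * cnj (U $$ (r4, c4)) \<partial>\<mu>)"
      by (rule Bochner_Integration.integral_cong[OF refl entry]) (simp add: space)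
    finally show "(\<integral>U. U $$ (r1, c1) * U $$ (r2, c2) * cnj (U $$ (r3, c3)) * cnj (U $$ (r4, c4)) \<partial>P)
      = (\<integral>U. U $$ (r1, c1) * U $$ (r2, c2) * cnj (U $$ (r3, c3)) * cnj (U $$ (r4, c4)) \<partial>\<mu>)" .
  qed
qed

lemma fourth_power_expand:
  fixes f :: "'i \<Rightarrow> complex"
  shows "complex_of_real ((cmod (\<Sum>x\<in>I. f x)) ^ 4)
    = (\<Sum>x1\<in>I. \<Sum>x2\<in>I. \<Sum>x3\<in>I. \<Sum>x4\<in>I. f x1 * f x2 * cnj (f x3) * cnj (f x4))"
proof -
  let ?z = "\<Sum>x\<in>I. f x"
  have "complex_of_real ((cmod z) ^ 4) = z * (z * (cnj z * cnj z))" for z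
  proof -
    have "complex_of_real ((cmod z) ^ 4) = complex_of_real ((cmod z)\<^sup>2) * complex_of_real ((cmod z)\<^sup>2)"
      by (simp flip: of_real_mult power_add)
    also have "\<dots> = z * (z * (cnj z * cnj z))"
      unfolding complex_norm_square by (simp only: mult_ac)
    finally show ?thesis .
  qed
  then have "complex_of_real ((cmod ?z) ^ 4) = ?z * (?z * (cnj ?z * cnj ?z))" .
  also have "\<dots> = (\<Sum>x1\<in>I. \<Sum>x2\<in>I. \<Sum>x3\<in>I. \<Sum>x4\<in>I. f x1 * (f x2 * (cnj (f x3) * cnj (f x4))))"
    unfolding cnj_sum sum_distrib_right unfolding sum_distrib_left ..
  finally show ?thesis by (simp only: mult.assoc)
qed

text \<open>The right side sees the measure only through moments of bidegree (2,2), so it takes the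
  same value for a design and for Haar measure. Entries bounded by 1 allow integration term by
  term.\<close>

lemma integral_fourth_power_expand:
  assumes N: "prob_space N" and sets: "sets N = sets (unitary_borel d)"
  shows "complex_of_real (\<integral>U. (cmod (\<Sum>x\<in>{..<d} \<times> {..<d}. c x * U $$ x)) ^ 4 \<partial>N)
    = (\<Sum>x1\<in>{..<d} \<times> {..<d}. \<Sum>x2\<in>{..<d} \<times> {..<d}. \<Sum>x3\<in>{..<d} \<times> {..<d}. \<Sum>x4\<in>{..<d} \<times> {..<d}.
        c x1 * c x2 * cnj (c x3) * cnj (c x4) * (\<integral>U. U $$ x1 * U $$ x2 * cnj (U $$ x3) * cnj (U $$ x4) \<partial>N))"
proof -
  interpret prob_space N by fact
  let ?I = "{..<d} \<times> {..<d}"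
  have space: "space N = unitary_group d" using sets by (metis sets_eq_imp_space_eq space_unitary_borel)
  have ent: "(\<lambda>U. U $$ x) \<in> borel_measurable N" if "x \<in> ?I" for x
  proof -
    have "(\<lambda>U. U $$ x) \<in> borel_measurable (unitary_borel d)"
      using that measurable_unitary_entry[of "fst x" d "snd x"] by (cases x) auto
    then show ?thesis by (simp only: measurable_cong_sets[OF sets refl])
  qed
  have cnj_ent: "(\<lambda>U. cnj (U $$ x)) \<in> borel_measurable N" if "x \<in> ?I" for x
    using ent[OF that] by (rule measurable_compose) (intro borel_measurable_continuous_onI continuous_intros)
  have le1: "cmod (U $$ x) \<le> 1" if "x \<in> ?I" "U \<in> space N" for x U
    using that unitary_group_entry_le_1[of U d "fst x" "snd x"] by (auto simp: space)
  have int: "integrable N (\<lambda>U. U $$ x1 * U $$ x2 * cnj (U $$ x3) * cnj (U $$ x4))"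
    if "x1 \<in> ?I" "x2 \<in> ?I" "x3 \<in> ?I" "x4 \<in> ?I" for x1 x2 x3 x4
  proof (rule integrable_const_bound)
    show "AE U in N. cmod (U $$ x1 * U $$ x2 * cnj (U $$ x3) * cnj (U $$ x4)) \<le> 1"
    proof (rule AE_I2)
      fix U assume "U \<in> space N"
      then have "cmod (U $$ x1) * cmod (U $$ x2) * cmod (U $$ x3) * cmod (U $$ x4) \<le> 1 * 1 * 1 * 1"
        using that by (intro mult_mono le1) auto
      then show "cmod (U $$ x1 * U $$ x2 * cnj (U $$ x3) * cnj (U $$ x4)) \<le> 1"
        by (simp add: norm_mult)
    qed
    show "(\<lambda>U. U $$ x1 * U $$ x2 * cnj (U $$ x3) * cnj (U $$ x4)) \<in> borel_measurable N"
      by (intro borel_measurable_times ent cnj_ent that)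
  qed
  define G where "G x1 x2 x3 x4 U = c x1 * c x2 * cnj (c x3) * cnj (c x4)
    * (U $$ x1 * U $$ x2 * cnj (U $$ x3) * cnj (U $$ x4))" for x1 x2 x3 x4 U
  have intG: "integrable N (G x1 x2 x3 x4)" if "x1 \<in> ?I" "x2 \<in> ?I" "x3 \<in> ?I" "x4 \<in> ?I" for x1 x2 x3 x4
    unfolding G_def by (intro integrable_mult_right int that)
  have "complex_of_real (\<integral>U. (cmod (\<Sum>x\<in>?I. c x * U $$ x)) ^ 4 \<partial>N)
    = (\<integral>U. complex_of_real ((cmod (\<Sum>x\<in>?I. c x * U $$ x)) ^ 4) \<partial>N)"
    by (rule integral_complex_of_real[symmetric])
  also have "\<dots> = (\<integral>U. (\<Sum>x1\<in>?I. \<Sum>x2\<in>?I. \<Sum>x3\<in>?I. \<Sum>x4\<in>?I. G x1 x2 x3 x4 U) \<partial>N)"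
    unfolding fourth_power_expand G_def
    by (intro Bochner_Integration.integral_cong sum.cong refl) (simp only: complex_cnj_mult mult_ac)
  also have "\<dots> = (\<Sum>x1\<in>?I. \<integral>U. (\<Sum>x2\<in>?I. \<Sum>x3\<in>?I. \<Sum>x4\<in>?I. G x1 x2 x3 x4 U) \<partial>N)"
    by (intro Bochner_Integration.integral_sum Bochner_Integration.integrable_sum intG)
  also have "\<dots> = (\<Sum>x1\<in>?I. \<Sum>x2\<in>?I. \<integral>U. (\<Sum>x3\<in>?I. \<Sum>x4\<in>?I. G x1 x2 x3 x4 U) \<partial>N)"
    by (intro sum.cong refl Bochner_Integration.integral_sum Bochner_Integration.integrable_sum intG)
  also have "\<dots> = (\<Sum>x1\<in>?I. \<Sum>x2\<in>?I. \<Sum>x3\<in>?I. \<integral>U. (\<Sum>x4\<in>?I. G x1 x2 x3 x4 U) \<partial>N)"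
    by (intro sum.cong refl Bochner_Integration.integral_sum Bochner_Integration.integrable_sum intG)
  also have "\<dots> = (\<Sum>x1\<in>?I. \<Sum>x2\<in>?I. \<Sum>x3\<in>?I. \<Sum>x4\<in>?I. \<integral>U. G x1 x2 x3 x4 U \<partial>N)"
    by (intro sum.cong refl Bochner_Integration.integral_sum Bochner_Integration.integrable_sum intG)
  finally show ?thesis unfolding G_def integral_mult_right_zero .
qed

lemma unitary_design_fourth_moment:
  assumes P: "unitary_design t (2 ^ k) P" and t: "2 \<le> t"
    and L: "L \<in> unitary_group (2 ^ k)" and i: "i < 2 ^ k"
  shows "(\<integral>U. row_moment (2 ^ k) v (L * U) i \<partial>P) \<le> 3 * (\<Sum>s<2 ^ k. (cmod (v s))\<^sup>2)\<^sup>2 / (2 ^ k)\<^sup>2"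
proof -
  let ?d = "2 ^ k :: nat"
  let ?I = "{..<?d} \<times> {..<?d}"
  obtain \<mu> where \<mu>: "is_haar ?d \<mu>" and
    mono: "\<And>r1 c1 r2 c2 r3 c3 r4 c4. \<lbrakk>r1 < ?d; c1 < ?d; r2 < ?d; c2 < ?d; r3 < ?d; c3 < ?d; r4 < ?d; c4 < ?d\<rbrakk> \<Longrightarrow>
      (\<integral>U. U $$ (r1, c1) * U $$ (r2, c2) * cnj (U $$ (r3, c3)) * cnj (U $$ (r4, c4)) \<partial>P)
      = (\<integral>U. U $$ (r1, c1) * U $$ (r2, c2) * cnj (U $$ (r3, c3)) * cnj (U $$ (r4, c4)) \<partial>\<mu>)"
    by (rule unitary_design_monomials[OF P t]) (rule that)
  \<comment> \<open>Row \<open>i\<close> of \<open>L * U\<close> applied to \<open>v\<close> is a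
    linear form in the entries of \<open>U\<close>; these are its coefficients, indexed by
    pairs.\<close>
  define c where "c x = L $$ (i, fst x) * v (snd x)" for x
  have row: "row_moment ?d v (L * U) i = (cmod (\<Sum>x\<in>?I. c x * U $$ x)) ^ 4" if "U \<in> unitary_group ?d" for U
    unfolding row_moment_def mat_mult_vec_sum[OF unitary_groupD(1)[OF L] unitary_groupD(1)[OF that] i]
    by (simp add: c_def sum.cartesian_product sum_distrib_left split_def mult_ac)
  have P': "prob_space P" "sets P = sets (unitary_borel ?d)" and \<mu>': "prob_space \<mu>" "sets \<mu> = sets (unitary_borel ?d)"
    using P \<mu> by (auto simp: unitary_design_def is_haar_def)
  have space: "space P = unitary_group ?d" "space \<mu> = unitary_group ?d"
    using P'(2) \<mu>'(2) by (metis sets_eq_imp_space_eq space_unitary_borel)+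
  have "complex_of_real (\<integral>U. (cmod (\<Sum>x\<in>?I. c x * U $$ x)) ^ 4 \<partial>P)
    = complex_of_real (\<integral>U. (cmod (\<Sum>x\<in>?I. c x * U $$ x)) ^ 4 \<partial>\<mu>)"
    unfolding integral_fourth_power_expand[OF P'] integral_fourth_power_expand[OF \<mu>']
    by (intro sum.cong refl arg_cong2[where f = "(*)"]) (auto intro!: mono)
  then have "(\<integral>U. (cmod (\<Sum>x\<in>?I. c x * U $$ x)) ^ 4 \<partial>P) = (\<integral>U. (cmod (\<Sum>x\<in>?I. c x * U $$ x)) ^ 4 \<partial>\<mu>)"
    by (simp only: of_real_eq_iff)
  also have "(\<integral>U. (cmod (\<Sum>x\<in>?I. c x * U $$ x)) ^ 4 \<partial>P) = (\<integral>U. row_moment ?d v (L * U) i \<partial>P)"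
    by (rule Bochner_Integration.integral_cong[OF refl row[symmetric]]) (simp add: space)
  also have "(\<integral>U. (cmod (\<Sum>x\<in>?I. c x * U $$ x)) ^ 4 \<partial>\<mu>) = (\<integral>U. row_moment ?d v (L * U) i \<partial>\<mu>)"
    by (rule Bochner_Integration.integral_cong[OF refl row[symmetric]]) (simp add: space)
  finally show ?thesis using haar_fourth_moment[OF \<mu> L i, of v] by simp
qed

section \<open>Collision probability of the measurement outcomes\<close>

text \<open>The probability of outcome \<open>i\<close> for a state with amplitudes
  \<open>m r s\<close>. The array is kept arbitrary so that a right factor of the circuit can be
  absorbed into it.\<close>

definition row_weight :: "nat \<Rightarrow> nat \<Rightarrow> (nat \<Rightarrow> nat \<Rightarrow> complex) \<Rightarrow> complex mat \<Rightarrow> nat \<Rightarrow> real" where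
  "row_weight n d m W i = (\<Sum>r<n. (cmod (\<Sum>s<d. W $$ (i, s) * m r s))\<^sup>2)"

text \<open>For normalized \<open>m\<close>, the probability that two independent runs give the same
  outcome.\<close>

definition collision :: "nat \<Rightarrow> nat \<Rightarrow> (nat \<Rightarrow> nat \<Rightarrow> complex) \<Rightarrow> complex mat \<Rightarrow> real" where
  "collision n d m W = (\<Sum>i<d. (row_weight n d m W i)\<^sup>2)"

lemma row_weight_nonneg: "0 \<le> row_weight n d m W i"
  by (simp add: row_weight_def sum_nonneg)

lemma row_weight_total:
  assumes "W \<in> unitary_group d"
  shows "(\<Sum>i<d. row_weight n d m W i) = (\<Sum>r<n. \<Sum>s<d. (cmod (m r s))\<^sup>2)"
  unfolding row_weight_def by (subst sum.swap) (simp only: unitary_group_norm_preserving[OF assms])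

lemma collision_bounds:
  assumes W: "W \<in> unitary_group d" and m: "(\<Sum>r<n. \<Sum>s<d. (cmod (m r s))\<^sup>2) = 1"
  shows "0 \<le> collision n d m W" "collision n d m W \<le> 1"
proof -
  show "0 \<le> collision n d m W" by (simp add: collision_def sum_nonneg)
  have le1: "row_weight n d m W i \<le> 1" if "i < d" for i
    using member_le_sum[of i "{..<d}" "row_weight n d m W"] that row_weight_nonneg[of n d m W]
      row_weight_total[OF W, of n m] m by auto
  have "collision n d m W \<le> (\<Sum>i<d. row_weight n d m W i)"
    unfolding collision_def power2_eq_square
    by (intro sum_mono mult_left_le_one_le row_weight_nonneg le1) auto
  then show "collision n d m W \<le> 1" by (simp add: row_weight_total[OF W] m)
qed

lemma collision_measurable: "collision n d m \<in> borel_measurable (unitary_borel d)"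
  unfolding collision_def[abs_def] row_weight_def
  by (intro borel_measurable_sum borel_measurable_power borel_measurable_norm borel_measurable_times
    measurable_unitary_entry) auto

lemma integrable_collision:
  assumes "prob_space N" and g: "g \<in> measurable N (unitary_borel d)"
    and m: "(\<Sum>r<n. \<Sum>s<d. (cmod (m r s))\<^sup>2) = 1"
  shows "integrable N (\<lambda>x. collision n d m (g x))"
proof -
  interpret prob_space N by fact
  show ?thesis
  proof (rule integrable_const_bound)
    show "AE x in N. norm (collision n d m (g x)) \<le> 1"
      using measurable_space[OF g] collision_bounds[OF _ m] by (intro AE_I2) auto
    show "(\<lambda>x. collision n d m (g x)) \<in> borel_measurable N"
      using measurable_compose[OF g collision_measurable] .
  qed
qed

text \<open>Jensen's inequality; rows \<open>m r = 0\<close> contribute \<open>0 / 0 = 0\<close> on the right.\<close>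

lemma row_weight_square_le:
  "(row_weight n d m W i)\<^sup>2
    \<le> (\<Sum>r<n. \<Sum>s<d. (cmod (m r s))\<^sup>2) * (\<Sum>r<n. row_moment d (m r) W i / (\<Sum>s<d. (cmod (m r s))\<^sup>2))"
proof -
  define w where "w r = (\<Sum>s<d. (cmod (m r s))\<^sup>2)" for r
  define x where "x r = (\<Sum>s<d. W $$ (i, s) * m r s)" for r
  have w0: "w r \<ge> 0" for r by (simp add: w_def sum_nonneg)
  \<comment> \<open>A row of weight 0 has amplitude 0, so dividing and multiplying by
    \<open>sqrt (w r)\<close> below is harmless even when this root is 0.\<close>
  have x0: "x r = 0" if "w r = 0" for r
    using that unfolding w_def x_def by (subst (asm) sum_nonneg_eq_0_iff) auto
  have "(row_weight n d m W i)\<^sup>2 = (\<Sum>r<n. sqrt (w r) * ((cmod (x r))\<^sup>2 / sqrt (w r)))\<^sup>2"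
  proof -
    have "(cmod (x r))\<^sup>2 = sqrt (w r) * ((cmod (x r))\<^sup>2 / sqrt (w r))" for r
      using x0[of r] by (cases "w r = 0") auto
    then show ?thesis by (simp only: row_weight_def x_def[symmetric])
  qed
  also have "\<dots> \<le> (\<Sum>r<n. (sqrt (w r))\<^sup>2) * (\<Sum>r<n. ((cmod (x r))\<^sup>2 / sqrt (w r))\<^sup>2)"
    by (rule Cauchy_Schwarz_ineq_sum)
  also have "\<dots> = (\<Sum>r<n. w r) * (\<Sum>r<n. row_moment d (m r) W i / w r)"
    using w0 by (simp add: power_divide row_moment_def x_def flip: power_mult)
  finally show ?thesis by (simp only: w_def)
qed

text \<open>After division by its weight, row \<open>r\<close> contributes at most
  \<open>3 * w r / (2 ^ k)\<^sup>2\<close> to each outcome. The weights sum to 1 and there are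
  \<open>2 ^ k\<close> outcomes.\<close>

lemma unitary_design_collision:
  assumes P: "unitary_design t (2 ^ k) P" and t: "2 \<le> t"
    and L: "L \<in> unitary_group (2 ^ k)"
    and m: "(\<Sum>r<n. \<Sum>s<2 ^ k. (cmod (m r s))\<^sup>2) = 1"
  shows "(\<integral>U. collision n (2 ^ k) m (L * U) \<partial>P) \<le> 3 / 2 ^ k"
proof -
  let ?d = "2 ^ k :: nat"
  define w where "w r = (\<Sum>s<?d. (cmod (m r s))\<^sup>2)" for r
  have w0: "w r \<ge> 0" for r by (simp add: w_def sum_nonneg)
  have w1: "(\<Sum>r<n. w r) = 1" using m by (simp add: w_def)
  have P': "prob_space P" "sets P = sets (unitary_borel ?d)" using P by (auto simp: unitary_design_def)
  interpret prob_space P by fact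
  have mult: "(\<lambda>U. L * U) \<in> measurable P (unitary_borel ?d)"
    using L by (intro measurable_unitary_mult measurable_ident_sets[OF P'(2)]) auto
  have int: "integrable P (\<lambda>U. row_moment ?d v (L * U) i)" if "i < ?d" for v i
    by (rule integrable_row_moment[OF P'(1) mult that])
  have "(\<integral>U. collision n ?d m (L * U) \<partial>P) \<le> (\<integral>U. (\<Sum>i<?d. \<Sum>r<n. row_moment ?d (m r) (L * U) i / w r) \<partial>P)"
  proof (rule integral_mono)
    show "integrable P (\<lambda>U. collision n ?d m (L * U))"
      by (rule integrable_collision[OF P'(1) mult m])
    show "integrable P (\<lambda>U. \<Sum>i<?d. \<Sum>r<n. row_moment ?d (m r) (L * U) i / w r)"
      by (intro Bochner_Integration.integrable_sum integrable_divide_zero int) auto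
    show "collision n ?d m (L * U) \<le> (\<Sum>i<?d. \<Sum>r<n. row_moment ?d (m r) (L * U) i / w r)" for U
      unfolding collision_def
      by (intro sum_mono order_trans[OF row_weight_square_le]) (simp add: m w_def)
  qed
  also have "\<dots> = (\<Sum>i<?d. \<Sum>r<n. (\<integral>U. row_moment ?d (m r) (L * U) i \<partial>P) / w r)"
  proof -
    have "(\<integral>U. (\<Sum>i<?d. \<Sum>r<n. row_moment ?d (m r) (L * U) i / w r) \<partial>P)
      = (\<Sum>i<?d. \<integral>U. (\<Sum>r<n. row_moment ?d (m r) (L * U) i / w r) \<partial>P)"
      by (intro Bochner_Integration.integral_sum Bochner_Integration.integrable_sum integrable_divide_zero int) auto
    also have "\<dots> = (\<Sum>i<?d. \<Sum>r<n. \<integral>U. row_moment ?d (m r) (L * U) i / w r \<partial>P)"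
      by (intro sum.cong refl Bochner_Integration.integral_sum integrable_divide_zero int) auto
    finally show ?thesis by simp
  qed
  also have "\<dots> \<le> (\<Sum>i<?d. \<Sum>r<n. 3 * w r / (2 ^ k)\<^sup>2)"
  proof (intro sum_mono)
    fix i r assume i: "i \<in> {..<?d}"
    have "(\<integral>U. row_moment ?d (m r) (L * U) i \<partial>P) / w r \<le> 3 * (w r)\<^sup>2 / (2 ^ k)\<^sup>2 / w r"
      using unitary_design_fourth_moment[OF P t L, of i "m r"] i w0
      by (intro divide_right_mono) (auto simp: w_def)
    \<comment> \<open>For \<open>w r = 0\<close> both sides are 0.\<close>
    also have "\<dots> = 3 * w r / (2 ^ k)\<^sup>2" by (simp add: power2_eq_square)
    finally show "(\<integral>U. row_moment ?d (m r) (L * U) i \<partial>P) / w r \<le> 3 * w r / (2 ^ k)\<^sup>2" .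
  qed
  also have "\<dots> = 2 ^ k * (3 * (\<Sum>r<n. w r) / (2 ^ k)\<^sup>2)"
    by (simp add: sum_distrib_left sum_divide_distrib)
  also have "\<dots> = 3 / 2 ^ k" by (simp add: w1 power2_eq_square)
  finally show ?thesis .
qed

text \<open>Letting the right factor act on the amplitudes reduces the case of a design on the left
  to that of a design on the right.\<close>

lemma collision_mult_right:
  assumes "L \<in> carrier_mat d d" "R \<in> carrier_mat d d"
  shows "collision n d m (L * R) = collision n d (\<lambda>r s. \<Sum>s'<d. R $$ (s, s') * m r s') L"
  unfolding collision_def row_weight_def
  by (intro sum.cong refl arg_cong2[where f = "(^)"] arg_cong[where f = cmod] mat_mult_vec_sum[OF assms]) auto

text \<open>Independence makes the joint law a product, so by Fubini the design factor is integrated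
  first with the other one fixed. The bound is uniform in the fixed factor and survives the outer
  integral.\<close>

lemma independent_design_collision:
  assumes M: "prob_space M"
    and indep: "prob_space.indep_var M (unitary_borel (2 ^ k)) L (unitary_borel (2 ^ k)) R"
    and design: "unitary_design t (2 ^ k) (distr M (unitary_borel (2 ^ k)) L)
      \<or> unitary_design t (2 ^ k) (distr M (unitary_borel (2 ^ k)) R)" and t: "2 \<le> t"
    and m: "(\<Sum>r<n. \<Sum>s<2 ^ k. (cmod (m r s))\<^sup>2) = 1"
  shows "(\<integral>x. collision n (2 ^ k) m (L x * R x) \<partial>M) \<le> 3 / 2 ^ k"
proof -
  let ?d = "2 ^ k :: nat"
  let ?B = "unitary_borel ?d"
  interpret prob_space M by fact
  have L: "L \<in> measurable M ?B" and R: "R \<in> measurable M ?B"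
    using indep by (blast dest: indep_var_rv1 indep_var_rv2)+
  define PL PR where "PL = distr M ?B L" and "PR = distr M ?B R"
  have joint: "PL \<Otimes>\<^sub>M PR = distr M (?B \<Otimes>\<^sub>M ?B) (\<lambda>x. (L x, R x))"
    using indep unfolding PL_def PR_def indep_var_distribution_eq by blast
  have PL: "prob_space PL" and PR: "prob_space PR"
    unfolding PL_def PR_def using L R by (auto intro: prob_space_distr)
  have setsPL: "sets PL = sets ?B" and setsPR: "sets PR = sets ?B" by (simp_all add: PL_def PR_def)
  interpret PL: prob_space PL by (rule PL)
  interpret PR: prob_space PR by (rule PR)
  interpret pair_prob_space PL PR by unfold_locales
  have mult: "(\<lambda>z. fst z * snd z) \<in> measurable (?B \<Otimes>\<^sub>M ?B) ?B"
    by (intro measurable_unitary_mult measurable_fst measurable_snd)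
  then have mult': "(\<lambda>z. fst z * snd z) \<in> measurable (PL \<Otimes>\<^sub>M PR) ?B"
    by (simp only: measurable_cong_sets[OF sets_pair_measure_cong[OF setsPL setsPR] refl])
  have int: "integrable (PL \<Otimes>\<^sub>M PR) (\<lambda>(l, r). collision n ?d m (l * r))"
    using integrable_collision[OF prob_space_axioms mult' m]
    by (simp add: split_def)
  have eq: "(\<integral>x. collision n ?d m (L x * R x) \<partial>M) = (\<integral>z. (case z of (l, r) \<Rightarrow> collision n ?d m (l * r)) \<partial>(PL \<Otimes>\<^sub>M PR))"
    unfolding joint split_def
    by (subst integral_distr)
      (use L R measurable_compose[OF mult collision_measurable, of n m] in \<open>auto intro: measurable_Pair\<close>)
  have spaceL: "space PL = unitary_group ?d" and spaceR: "space PR = unitary_group ?d"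
    by (simp_all add: PL_def PR_def)
  show ?thesis
    using design
  proof
    assume "unitary_design t ?d (distr M ?B R)"
    then have D: "unitary_design t ?d PR" by (simp add: PR_def)
    have "(\<integral>x. collision n ?d m (L x * R x) \<partial>M) = (\<integral>l. (\<integral>r. collision n ?d m (l * r) \<partial>PR) \<partial>PL)"
      unfolding eq by (rule integral_fst[OF int, symmetric])
    also have "\<dots> \<le> 3 / 2 ^ k"
      by (rule PL.integral_le_const[OF integrable_fst[OF int]])
        (auto intro!: AE_I2 unitary_design_collision[OF D t _ m] simp: spaceL)
    finally show ?thesis .
  next
    assume "unitary_design t ?d (distr M ?B L)"
    then have D: "unitary_design t ?d PL" by (simp add: PL_def)
    have "(\<integral>x. collision n ?d m (L x * R x) \<partial>M) = (\<integral>r. (\<integral>l. collision n ?d m (l * r) \<partial>PL) \<partial>PR)"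
      unfolding eq by (rule integral_snd[OF int, symmetric])
    also have "\<dots> \<le> 3 / 2 ^ k"
    proof (rule PR.integral_le_const[OF integrable_snd[OF int]], rule AE_I2)
      fix r assume "r \<in> space PR"
      then have r: "r \<in> unitary_group ?d" by (simp add: spaceR)
      \<comment> \<open>The fixed right part \<open>r\<close> is absorbed into the amplitudes, which
        stay normalized; the design then stands to the right of the identity.\<close>
      define m' where "m' a s = (\<Sum>s'<?d. r $$ (s, s') * m a s')" for a s
      have m': "(\<Sum>a<n. \<Sum>s<?d. (cmod (m' a s))\<^sup>2) = 1"
        unfolding m'_def unitary_group_norm_preserving[OF r] by (rule m)
      have "(\<integral>l. collision n ?d m (l * r) \<partial>PL) = (\<integral>l. collision n ?d m' (1\<^sub>m ?d * l) \<partial>PL)"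
      proof (rule Bochner_Integration.integral_cong[OF refl])
        fix l assume "l \<in> space PL"
        then have l: "l \<in> carrier_mat ?d ?d" by (auto simp: spaceL dest: unitary_groupD)
        then show "collision n ?d m (l * r) = collision n ?d m' (1\<^sub>m ?d * l)"
          using unitary_groupD(1)[OF r] by (simp add: collision_mult_right m'_def[abs_def])
      qed
      also have "\<dots> \<le> 3 / 2 ^ k"
        by (rule unitary_design_collision[OF D t unitary_group_one m'])
      finally show "(\<integral>l. collision n ?d m (l * r) \<partial>PL) \<le> 3 / 2 ^ k" .
    qed
    finally show ?thesis .
  qed
qed

text \<open>
  If \<open>X\<close> is not integrable, its Bochner integral is 0 and its variance is the integral of \<open>X\<^sup>2\<close>.
\<close>

lemma variance_le_of_square_le:
  fixes X Y :: "'a \<Rightarrow> real"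
  assumes M: "prob_space M" and Y: "integrable M Y"
    and le: "\<And>x. x \<in> space M \<Longrightarrow> (X x)\<^sup>2 \<le> Y x"
  shows "prob_space.variance M X \<le> (\<integral>x. Y x \<partial>M)"
proof -
  interpret prob_space M by fact
  have Y0: "0 \<le> Y x" if "x \<in> space M" for x
    using le[OF that] by (meson order_trans zero_le_power2)
  have square: "(\<integral>x. (X x)\<^sup>2 \<partial>M) \<le> (\<integral>x. Y x \<partial>M)"
  proof (cases "integrable M (\<lambda>x. (X x)\<^sup>2)")
    case True
    then show ?thesis by (intro integral_mono Y le)
  next
    \<comment> \<open>The Bochner integral of the square is then 0 by convention.\<close>
    case False
    then show ?thesis using Y0 by (simp add: not_integrable_integral_eq integral_nonneg_AE)
  qed
  show ?thesis
  proof (cases "integrable M X")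
    case True
    \<comment> \<open>Measurability of \<open>X\<close> comes with its integrability, and
      \<open>Y\<close> dominates the square.\<close>
    have "integrable M (\<lambda>x. (X x)\<^sup>2)"
      by (rule Bochner_Integration.integrable_bound[OF Y])
        (use True le Y0 in \<open>auto intro!: AE_I2 borel_measurable_power\<close>)
    from variance_eq[OF True this] square show ?thesis
      using zero_le_power2[of "expectation X"] by linarith
  next
    case False
    then show ?thesis using square by (simp add: not_integrable_integral_eq)
  qed
qed

theorem theorem2p3:
  shows "\<exists>C::real. C > 0 \<and>
    (\<forall>(k::nat) (dA::nat) (dB::nat) (p::nat \<Rightarrow> real) (\<psi>::nat \<Rightarrow> complex vec) (\<rho>::complex mat)
      (N::nat) (j::nat) (E::nat \<Rightarrow> complex mat) (S::pauli list)
      (M::((nat \<Rightarrow> real) \<times> (nat \<Rightarrow> pauli list)) measure).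
      pure_ensemble (dA * dB) (2 ^ k) p \<psi> \<rho> \<longrightarrow>
      j \<in> {1..N} \<longrightarrow>
      (\<forall>l\<in>{1..N}. E l \<in> unitary_group (2 ^ k)) \<longrightarrow>
      S \<in> pauli_strings k \<longrightarrow>
      prob_space M \<longrightarrow> sets M = sets (param_space k N j S) \<longrightarrow>
      sufficient_depth (2 ^ k) N j E M \<longrightarrow>
      prob_space.variance M
        (cost_deriv dA dB (2 ^ k) (purification (dA * dB) (2 ^ k) p \<psi>) N E j) \<le> C / 2 ^ k)"
proof (intro exI[of _ "192"] conjI allI impI)
  fix k dA dB :: nat and p \<psi> \<rho> and N j :: nat and E S and M :: "((nat \<Rightarrow> real) \<times> (nat \<Rightarrow> pauli list)) measure"
  let ?d = "2 ^ k :: nat" and ?n = "dA * dB"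
  assume ens: "pure_ensemble ?n ?d p \<psi> \<rho>" and j: "j \<in> {1..N}"
    and E: "\<forall>l\<in>{1..N}. E l \<in> unitary_group ?d" and S: "S \<in> pauli_strings k"
    and M: "prob_space M" "sets M = sets (param_space k N j S)" and depth: "sufficient_depth ?d N j E M"
  define \<Psi> where "\<Psi> = purification ?n ?d p \<psi>"
  define m where "m r s = \<Psi> $ (r * ?d + s)" for r s
  have dim: "dim_vec \<Psi> = ?n * ?d" by (simp add: \<Psi>_def purification_def)
  have norm: "(\<Sum>r<?n. \<Sum>s<?d. (cmod (m r s))\<^sup>2) = 1"
    unfolding m_def \<Psi>_def by (rule purification_norm[OF ens])
  define L where "L = (\<lambda>(\<theta>, V). circuit ?d E V \<theta> 1 j)"
  define R where "R = (\<lambda>(\<theta>, V). circuit ?d E V \<theta> (Suc j) N)"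
  have indep: "prob_space.indep_var M (unitary_borel ?d) L (unitary_borel ?d) R"
    and design: "unitary_design 4 ?d (distr M (unitary_borel ?d) L) \<or> unitary_design 4 ?d (distr M (unitary_borel ?d) R)"
    using depth by (simp_all add: sufficient_depth_def L_def R_def Let_def)
  interpret prob_space M by (rule M(1))
  have L: "L \<in> measurable M (unitary_borel ?d)" and R: "R \<in> measurable M (unitary_borel ?d)"
    using indep by (blast dest: indep_var_rv1 indep_var_rv2)+
  have V: "length (V l) = k" if "(\<theta>, V) \<in> space M" "l \<in> {1..N}" for \<theta> V l
  proof -
    \<comment> \<open>The sample space fixes the string at \<open>j\<close> to be \<open>S\<close>
      and draws the others from \<open>pauli_strings k\<close>, so all have length
      \<open>k\<close>.\<close>
    have "V l \<in> (if l = j then {S} else pauli_strings k)"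
      using that by (auto simp: sets_eq_imp_space_eq[OF M(2)] param_space_def space_pair_measure space_PiM PiE_iff
        split: if_splits)
    then show ?thesis using S by (auto simp: pauli_strings_def split: if_splits)
  qed
  have "variance (cost_deriv dA dB ?d \<Psi> N E j) \<le> (\<integral>x. 64 * collision ?n ?d m (L x * R x) \<partial>M)"
  proof (rule variance_le_of_square_le[OF M(1)])
    show "integrable M (\<lambda>x. 64 * collision ?n ?d m (L x * R x))"
      by (intro integrable_mult_right integrable_collision[OF M(1) _ norm] measurable_unitary_mult L R)
    fix x assume x: "x \<in> space M"
    obtain \<theta> V where xV: "x = (\<theta>, V)" by (cases x)
    have "(cost_deriv dA dB ?d \<Psi> N E j (\<theta>, V))\<^sup>2 \<le> 64 * collision ?n ?d m (circuit ?d E V \<theta> 1 N)"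
      using cost_deriv_bound[of N V k E j \<Psi> dA dB \<theta>] V[OF x[unfolded xV]] E j dim norm
      by (simp add: collision_def row_weight_def branch_def m_def)
    also have "circuit ?d E V \<theta> 1 N = L x * R x"
      unfolding L_def R_def xV split_conv
      using V[OF x[unfolded xV]] E j by (intro circuit_append) auto
    finally show "(cost_deriv dA dB ?d \<Psi> N E j x)\<^sup>2 \<le> 64 * collision ?n ?d m (L x * R x)"
      by (simp only: xV)
  qed
  also have "\<dots> = 64 * (\<integral>x. collision ?n ?d m (L x * R x) \<partial>M)" by simp
  \<comment> \<open>The 64 is the square of the 8 in the derivative bound and the 3 is Khintchine's
    constant; their product is the witness 192.\<close>
  also have "\<dots> \<le> 64 * (3 / 2 ^ k)"
    by (intro mult_left_mono independent_design_collision[OF M(1) indep design _ norm]) auto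
  finally show "variance (cost_deriv dA dB ?d (purification ?n ?d p \<psi>) N E j) \<le> 192 / 2 ^ k"
    by (simp add: \<Psi>_def)
qed simp

end
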